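(* Fix a cooperative Markov game, target and avoid sets, and a stationary joint policy $\pi$ with $v^{full}>0$, as described in the context. Let $q\in[0,1]$. Let the communication availabilities $\lambda_0,\lambda_1,\dots$ be i.i.d. Bernoulli with $\Pr(\lambda_t=1)=1-q$, independent of the game's randomness. Let $v^{int}$ be the reach-avoid probability when the policy is executed with intermittent communication (Algorithm 2) under this random availability sequence. Then $$v^{int}\ge\max\Big(v^{full}-\sqrt{1-\exp(-q\,C_\pi)},\;v^{full}(1-q)^{\,l^{full}/v^{full}}\Big).$$
   Context: Multiagent model: there are $N$ agents. Agent $i$ is modeled by a finite MDP $\mathcal{M}^i=(\mathcal{S}^i,s_I^i,\mathcal{A}^i,\mathcal{T}^i)$. Here $\mathcal{S}^i$ is a finite state set, $s_I^i\in\mathcal{S}^i$ is the initial state, $\mathcal{A}^i$ is a finite action set, and $\mathcal{T}^i:\mathcal{S}^i\times\mathcal{A}^i\to\Delta(\mathcal{S}^i)$ is the transition kernel. The cooperative Markov game has joint state set $\mathbf{S}=\prod_i\mathcal{S}^i$, joint initial state $\mathbf{s}_I=(s_I^1,\dots,s_I^N)$, and joint action set $\mathbf{A}=\prod_i\mathcal{A}^i$. Its transition kernel is $\mathbf{T}(\mathbf{s},\mathbf{a},\mathbf{y})=\prod_{i}\mathcal{T}^i(s^i,a^i,y^i)$. A stationary joint policy is a map $\pi:\mathbf{S}\to\Delta(\mathbf{A})$. A joint path is an infinite sequence $\mathbf{s}_0\mathbf{a}_0\mathbf{s}_1\mathbf{a}_1\cdots\in(\mathbf{S}\times\mathbf{A})^\omega$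 with $\mathbf{s}_0=\mathbf{s}_I$. All random sampling below is mutually independent given the stated conditioning. Full-communication execution: at each time $t$, $\mathbf{a}_t\sim\pi(\mathbf{s}_t)$ is drawn once for the whole team. Each agent $i$ then moves to $s^i_{t+1}\sim\mathcal{T}^i(s^i_t,a^i_t)$. $\Gamma^{full}$ denotes the resulting distribution over joint paths. Imaginary play with loss time $0$ ($\Gamma^{img}_0$): from time $0$ on, each agent $i$ acts separately and does not observe the others. It sets $\hat s^j_{0,i}=s_I^j$ for $j\ne i$ at $t=0$, and at $t\ge1$ samples $\hat s^j_{t,i}\sim\mathcal{T}^j(\hat s^j_{t-1,i},\hat a^j_{t-1,i})$. It then samples $\hat{\mathbf a}_{t,i}\sim\pi(\hat s^1_{t,i},\dots,s^i_t,\dots,\hat s^N_{t,i})$, executes its component $\hat a^i_{t,i}$, and moves to $s^i_{t+1}\sim\mathcal{T}^i(s^i_t,\hat a^i_{t,i})$. $\Gamma^{img}_0$ is the induced distribution over realized joint paths. Intermittent communication with availability sequence $\Lambda=\lambda_0\lambda_1\cdots\in\{0,1\}^\omega$ (Algorithm 2): at each time $t$, the team acts as follows. - If $\lambda_t=1$, the team acts as under full communication. It samples a single $\mathbf a_t\sim\pi(\mathbf s_t)$, and each agent $i$ sets $\hat s^j_{t,i}=s^j_t$ for $j\neq i$ and $\hat{\mathbf a}_{t,i}=\mathbf a_t$. - If $\lambda_t=0$, each agent $i$ acts separately. First it sets its imaginary teammate states. If $t=0$, it sets $\hat s^j_{0,i}=s_I^j$; otherwise it samples $\hat s^j_{t,i}\sim\mathcal{T}^j(\hat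 s^j_{t-1,i},\hat a^j_{t-1,i})$ for $j\ne i$. - It then samples $\hat{\mathbf a}_{t,i}\sim\pi(\hat s^1_{t,i},\dots,s^i_t,\dots,\hat s^N_{t,i})$, and executes its component $\hat a^i_{t,i}$. - Each agent $i$ moves to $s^i_{t+1}\sim\mathcal{T}^i(s^i_t,\cdot)$ under the action it executed. Total correlation: let $\mathbf X$ be the random joint path under $\Gamma^{full}$, and $X^i$ its projection $s^i_0a^i_0s^i_1a^i_1\cdots$ onto agent $i$. The total correlation of $\pi$ is $$C_\pi=\Big[\sum_{i=1}^N H(X^i)\Big]-H(\mathbf X)=KL(\Gamma^{full}\|\Gamma^{img}_0).$$ Reach-avoid objective: a target set $\mathbf S_{\mathcal T}\subseteq\mathbf S$ and an avoid set $\mathbf S_{\mathcal A}\subseteq\mathbf S$ are given. A joint path succeeds if there is $M$ with $\mathbf s_M\in\mathbf S_{\mathcal T}$ and $\mathbf s_t\notin\mathbf S_{\mathcal A}$ for all $t<M$. $v^{full}$ is the success probability under $\Gamma^{full}$. Path length: $\mathbf S_{\mathcal D}$ is the set of joint states from which, under $\pi$ with full communication, the probability of success is $0$. For a path $\xi$, $len(\xi)=\min\{t+1:\mathbf s_t\in\mathbf S_{\mathcal T}\cup\mathbf S_{\mathcal D}\}$. Finally, $l^{full}=\mathbb E_{\xi\sim\Gamma^{full}}[len(\xi)]$. *)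

theory Defs
  imports "HOL-Probability.Probability"
begin

(* Agents are indexed by a finite type 'n (N = CARD('n)); local states live in a finite
   type 'st, local actions in a finite type 'ac.  Joint states are 'n => 'st, joint actions
   'n => 'ac.  Agent i has state set S i, action set A i, initial state sI i and kernel T i. *)

primrec markov_prefix :: "'x pmf \<Rightarrow> ('x \<Rightarrow> 'x pmf) \<Rightarrow> nat \<Rightarrow> 'x list pmf" where
  "markov_prefix \<mu> K 0 = return_pmf []"
| "markov_prefix \<mu> K (Suc n) =
     bind_pmf \<mu> (\<lambda>x. bind_pmf (markov_prefix (K x) K n) (\<lambda>xs. return_pmf (x # xs)))"

definition path_measure :: "(nat \<Rightarrow> 'y list pmf) \<Rightarrow> 'y stream measure" where
  "path_measure P = (THE M. sets M = sets (stream_space (count_space UNIV)) \<and>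
      (\<forall>n xs. emeasure M {\<omega> \<in> space M. stake n \<omega> = xs} = ennreal (pmf (P n) xs)))"

definition joint_T :: "('n::finite \<Rightarrow> 'st \<Rightarrow> 'ac \<Rightarrow> 'st pmf) \<Rightarrow> ('n \<Rightarrow> 'st) \<Rightarrow> ('n \<Rightarrow> 'ac)
    \<Rightarrow> ('n \<Rightarrow> 'st) pmf" where
  "joint_T T s a = Pi_pmf UNIV undefined (\<lambda>i. T i (s i) (a i))"

definition full_init :: "(('n \<Rightarrow> 'st) \<Rightarrow> ('n \<Rightarrow> 'ac) pmf) \<Rightarrow> ('n \<Rightarrow> 'st)
    \<Rightarrow> (('n \<Rightarrow> 'st) \<times> ('n \<Rightarrow> 'ac)) pmf" where
  "full_init \<pi> s0 = map_pmf (\<lambda>a. (s0, a)) (\<pi> s0)"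

definition full_kernel :: "('n::finite \<Rightarrow> 'st \<Rightarrow> 'ac \<Rightarrow> 'st pmf) \<Rightarrow> (('n \<Rightarrow> 'st) \<Rightarrow> ('n \<Rightarrow> 'ac) pmf)
    \<Rightarrow> ('n \<Rightarrow> 'st) \<times> ('n \<Rightarrow> 'ac) \<Rightarrow> (('n \<Rightarrow> 'st) \<times> ('n \<Rightarrow> 'ac)) pmf" where
  "full_kernel T \<pi> x = bind_pmf (joint_T T (fst x) (snd x))
      (\<lambda>s'. map_pmf (\<lambda>a'. (s', a')) (\<pi> s'))"

definition full_paths :: "('n::finite \<Rightarrow> 'st \<Rightarrow> 'ac \<Rightarrow> 'st pmf) \<Rightarrow> (('n \<Rightarrow> 'st) \<Rightarrow> ('n \<Rightarrow> 'ac) pmf)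
    \<Rightarrow> ('n \<Rightarrow> 'st) \<Rightarrow> (('n \<Rightarrow> 'st) \<times> ('n \<Rightarrow> 'ac)) stream measure" where
  "full_paths T \<pi> s0 = path_measure (markov_prefix (full_init \<pi> s0) (full_kernel T \<pi>))"

text \<open>Augmented state at time t (after the decisions of time t):
  (s_t, sh, ah) where s_t is the real joint state, sh i is the joint state agent i feeds
  to pi (its own real component together with its imaginary teammate states), and ah i is
  the joint action agent i sampled (it executes ah i i).\<close>

type_synonym ('n, 'st, 'ac) aug = "('n \<Rightarrow> 'st) \<times> ('n \<Rightarrow> 'n \<Rightarrow> 'st) \<times> ('n \<Rightarrow> 'n \<Rightarrow> 'ac)"

definition decide :: "(('n::finite \<Rightarrow> 'st) \<Rightarrow> ('n \<Rightarrow> 'ac) pmf) \<Rightarrow> bool \<Rightarrow> ('n \<Rightarrow> 'st)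
    \<Rightarrow> ('n \<Rightarrow> 'n \<Rightarrow> 'st) pmf \<Rightarrow> ('n, 'st, 'ac) aug pmf" where
  "decide \<pi> b s imag =
     (if b then map_pmf (\<lambda>a. (s, \<lambda>i. s, \<lambda>i. a)) (\<pi> s)
      else bind_pmf imag (\<lambda>sh. map_pmf (\<lambda>ah. (s, sh, ah))
                                 (Pi_pmf UNIV undefined (\<lambda>i. \<pi> (sh i)))))"

definition imag_step :: "('n::finite \<Rightarrow> 'st \<Rightarrow> 'ac \<Rightarrow> 'st pmf) \<Rightarrow> ('n \<Rightarrow> 'st)
    \<Rightarrow> ('n \<Rightarrow> 'n \<Rightarrow> 'st) \<Rightarrow> ('n \<Rightarrow> 'n \<Rightarrow> 'ac) \<Rightarrow> ('n \<Rightarrow> 'n \<Rightarrow> 'st) pmf" where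
  "imag_step T s' sh ah = Pi_pmf UNIV undefined (\<lambda>i. Pi_pmf UNIV undefined
      (\<lambda>j. if j = i then return_pmf (s' i) else T j (sh i j) (ah i j)))"

definition int_init :: "(('n::finite \<Rightarrow> 'st) \<Rightarrow> ('n \<Rightarrow> 'ac) pmf) \<Rightarrow> ('n \<Rightarrow> 'st) \<Rightarrow> bool pmf
    \<Rightarrow> ('n, 'st, 'ac) aug pmf" where
  "int_init \<pi> sI \<nu> = bind_pmf \<nu> (\<lambda>b. decide \<pi> b sI (return_pmf (\<lambda>i. sI)))"

definition int_kernel :: "('n::finite \<Rightarrow> 'st \<Rightarrow> 'ac \<Rightarrow> 'st pmf) \<Rightarrow> (('n \<Rightarrow> 'st) \<Rightarrow> ('n \<Rightarrow> 'ac) pmf)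
    \<Rightarrow> bool pmf \<Rightarrow> ('n, 'st, 'ac) aug \<Rightarrow> ('n, 'st, 'ac) aug pmf" where
  "int_kernel T \<pi> \<nu> x = (case x of (s, sh, ah) \<Rightarrow>
     bind_pmf (joint_T T s (\<lambda>i. ah i i)) (\<lambda>s'.
     bind_pmf \<nu> (\<lambda>b. decide \<pi> b s' (imag_step T s' sh ah))))"

definition realize :: "('n, 'st, 'ac) aug \<Rightarrow> ('n \<Rightarrow> 'st) \<times> ('n \<Rightarrow> 'ac)" where
  "realize x = (case x of (s, sh, ah) \<Rightarrow> (s, \<lambda>i. ah i i))"

definition int_paths :: "('n::finite \<Rightarrow> 'st \<Rightarrow> 'ac \<Rightarrow> 'st pmf) \<Rightarrow> (('n \<Rightarrow> 'st) \<Rightarrow> ('n \<Rightarrow> 'ac) pmf)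
    \<Rightarrow> ('n \<Rightarrow> 'st) \<Rightarrow> bool pmf \<Rightarrow> (('n \<Rightarrow> 'st) \<times> ('n \<Rightarrow> 'ac)) stream measure" where
  "int_paths T \<pi> sI \<nu> =
     path_measure (\<lambda>n. map_pmf (map realize) (markov_prefix (int_init \<pi> sI \<nu>) (int_kernel T \<pi> \<nu>) n))"

definition img0_paths :: "('n::finite \<Rightarrow> 'st \<Rightarrow> 'ac \<Rightarrow> 'st pmf) \<Rightarrow> (('n \<Rightarrow> 'st) \<Rightarrow> ('n \<Rightarrow> 'ac) pmf)
    \<Rightarrow> ('n \<Rightarrow> 'st) \<Rightarrow> (('n \<Rightarrow> 'st) \<times> ('n \<Rightarrow> 'ac)) stream measure" where
  "img0_paths T \<pi> sI = int_paths T \<pi> sI (return_pmf False)"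

definition reach_avoid :: "('s set) \<Rightarrow> ('s set) \<Rightarrow> ('s \<times> 'a) stream set" where
  "reach_avoid ST SA = {\<omega>. \<exists>M. fst (\<omega> !! M) \<in> ST \<and> (\<forall>t<M. fst (\<omega> !! t) \<notin> SA)}"

definition path_len :: "('s set) \<Rightarrow> ('s \<times> 'a) stream \<Rightarrow> ennreal" where
  "path_len U \<omega> = (if \<exists>t. fst (\<omega> !! t) \<in> U then of_nat (LEAST t. fst (\<omega> !! t) \<in> U) + 1 else \<infinity>)"

definition KL :: "'a measure \<Rightarrow> 'a measure \<Rightarrow> ennreal" where
  "KL P Q = (if absolutely_continuous Q P \<and> integrable P (entropy_density (exp 1) Q P)
             then ennreal (KL_divergence (exp 1) Q P) else \<infinity>)"

end

theory Submission
  imports Defs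
begin

text \<open>Fix the availability bits. Between two communications the agents' imagined histories are
  independent copies of the full-communication chain, each conditioned on what its agent has observed,
  so the likelihood of a realized path factorizes over time: a step with communication costs nothing
  against the full-communication law, and a step without it costs the log-ratio between the joint
  conditional law and the product of the agents' conditional laws of their own next step. An earlier
  communication only adds to what the agents condition on, hence in mean the cost of a lost step is at
  most its cost when communication was never available. Averaging over the bits (concavity of the
  logarithm) bounds the divergence of each path prefix by \<open>q\<close> times that of imaginary play, which is
  at most \<open>q C\<close> by data processing, and the Bretagnolle--Huber inequality gives the first bound.

  For the second bound, a prefix of length \<open>n\<close> is at least \<open>(1 - q)\<^sup>n\<close> times as likely under
  intermittent as under full communication. Summing over the time of the first visit to the target and
  applying Jensen's inequality finishes the proof, because a successful path almost surely avoids the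
  states from which success is impossible, so its first visit to the target is also its length.\<close>

section \<open>Markov paths\<close>

text \<open>The law of realized steps under intermittent play need not be Markov, since it depends
  on hidden imaginations. Its likelihood is therefore found by marginalizing a larger chain, and the
  formula is established only for paths that full communication can produce. That suffices: a
  divergence is a mean under the full-communication law, and the second bound needs lower bounds on
  such paths only. Success is not decided by a prefix of any fixed length. It is cut into disjoint
  events according to the time of the first visit to the target; these depend on finite prefixes,
  where all laws are finite sums, and the limit in the prefix length is taken last. The exponent
  \<open>l_full / v_full\<close> comes from conditioning: the mean length restricted to success is
  at most \<open>l_full\<close>, so the mean given success is at most
  \<open>l_full / v_full\<close>.\<close>

definition next_step :: "'x pmf \<Rightarrow> ('x \<Rightarrow> 'x pmf) \<Rightarrow> 'x list \<Rightarrow> 'x pmf" where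
  "next_step \<mu> K h = (case h of [] \<Rightarrow> \<mu> | x # _ \<Rightarrow> K x)"

primrec rev_path :: "'x pmf \<Rightarrow> ('x \<Rightarrow> 'x pmf) \<Rightarrow> nat \<Rightarrow> 'x list pmf" where
  "rev_path \<mu> K 0 = return_pmf []"
| "rev_path \<mu> K (Suc n) =
     bind_pmf (rev_path \<mu> K n) (\<lambda>h. map_pmf (\<lambda>x. x # h) (next_step \<mu> K h))"

primrec path_weight :: "'x pmf \<Rightarrow> ('x \<Rightarrow> 'x pmf) \<Rightarrow> 'x list \<Rightarrow> real" where
  "path_weight \<mu> K [] = 1"
| "path_weight \<mu> K (x # h) = path_weight \<mu> K h * pmf (next_step \<mu> K h) x"

text \<open>\<open>markov_prefix\<close> unfolds the first step, while the likelihoods below grow at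
  the latest one. The two orders agree because after its first step \<open>x\<close> the chain is
  again one with initial law \<open>K x\<close>; hence the induction over all initial laws.\<close>

lemma markov_prefix_snoc:
  "markov_prefix \<mu> K (Suc n) = bind_pmf (markov_prefix \<mu> K n)
     (\<lambda>xs. map_pmf (\<lambda>x. xs @ [x]) (next_step \<mu> K (rev xs)))"
proof (induction n arbitrary: \<mu>)
  case 0
  show ?case by (simp add: bind_return_pmf next_step_def map_pmf_def)
next
  case (Suc n)
  have *: "next_step \<mu> K (rev (x # xs)) = next_step (K x) K (rev xs)" for x xs
    by (cases "rev xs") (auto simp: next_step_def)
  have "markov_prefix \<mu> K (Suc (Suc n)) = bind_pmf \<mu> (\<lambda>x.
      bind_pmf (markov_prefix (K x) K (Suc n)) (\<lambda>xs. return_pmf (x # xs)))"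
    by (simp only: markov_prefix.simps)
  also have "\<dots> = bind_pmf \<mu> (\<lambda>x. bind_pmf (markov_prefix (K x) K n) (\<lambda>xs.
      map_pmf (\<lambda>y. x # xs @ [y]) (next_step (K x) K (rev xs))))"
    unfolding Suc.IH by (simp add: bind_assoc_pmf map_pmf_def bind_return_pmf)
  also have "\<dots> = bind_pmf (markov_prefix \<mu> K (Suc n))
     (\<lambda>xs. map_pmf (\<lambda>x. xs @ [x]) (next_step \<mu> K (rev xs)))"
    by (simp add: bind_assoc_pmf bind_return_pmf *[simplified])
  finally show ?case .
qed

lemma markov_prefix_eq_rev_path: "markov_prefix \<mu> K n = map_pmf rev (rev_path \<mu> K n)"
proof (induction n)
  case (Suc n)
  show ?case unfolding markov_prefix_snoc Suc.IH
    by (simp add: map_bind_pmf bind_map_pmf pmf.map_comp comp_def)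
qed simp

lemma path_weight_nonneg [simp]: "0 \<le> path_weight \<mu> K h"
  by (induction h) auto

lemma pmf_rev_path: "pmf (rev_path \<mu> K n) h = (if length h = n then path_weight \<mu> K h else 0)"
proof (induction n arbitrary: h)
  case 0
  show ?case by (cases h) auto
next
  case (Suc n)
  have "pmf (rev_path \<mu> K (Suc n)) h
      = measure_pmf.expectation (rev_path \<mu> K n) (\<lambda>g. pmf (map_pmf (\<lambda>x. x # g) (next_step \<mu> K g)) h)"
    by (simp add: pmf_bind)
  also have "\<dots> = (if length h = Suc n then path_weight \<mu> K h else 0)"
  proof (cases h)
    case Nil
    have "pmf (map_pmf (\<lambda>x. x # g) (next_step \<mu> K g)) [] = 0" for g
      by (auto simp: pmf_eq_0_set_pmf)
    then show ?thesis using Nil by simp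
  next
    case (Cons x t)
    have "pmf (map_pmf (\<lambda>x. x # g) (next_step \<mu> K g)) (x # t)
        = pmf (next_step \<mu> K t) x * indicator {t} g" for g
    proof (cases "g = t")
      case True
      have "inj (\<lambda>x. x # t)" by (auto simp: inj_def)
      then show ?thesis using True using pmf_map_inj'[of "\<lambda>x. x # t" "next_step \<mu> K t" x] by simp
    qed (auto simp: pmf_eq_0_set_pmf)
    then show ?thesis using Cons Suc.IH
      by (simp add: measure_pmf_single)
  qed
  finally show ?case .
qed

lemma pmf_markov_prefix:
  "pmf (markov_prefix \<mu> K n) xs = (if length xs = n then path_weight \<mu> K (rev xs) else 0)"
proof -
  have "pmf (map_pmf rev (rev_path \<mu> K n)) (rev (rev xs)) = pmf (rev_path \<mu> K n) (rev xs)"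
    by (intro pmf_map_inj') auto
  then show ?thesis by (simp add: markov_prefix_eq_rev_path pmf_rev_path)
qed

definition lists_len :: "nat \<Rightarrow> 'x list set" where
  "lists_len n = {h. length h = n}"

lemma finite_lists_len [simp]: "finite (lists_len n :: 'x::finite list set)"
  unfolding lists_len_def using finite_lists_length_eq[of "UNIV::'x set" n] by simp

lemma lists_len_0 [simp]: "lists_len 0 = {[]}"
  by (auto simp: lists_len_def)

lemma mem_lists_len [simp]: "h \<in> lists_len n \<longleftrightarrow> length h = n"
  by (simp add: lists_len_def)

lemma sum_lists_len_Suc:
  fixes f :: "'x::finite list \<Rightarrow> 'b::comm_monoid_add"
  shows "(\<Sum>h\<in>lists_len (Suc n). f h) = (\<Sum>h\<in>lists_len n. \<Sum>x\<in>UNIV. f (x # h))"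
proof -
  have "(\<Sum>h\<in>lists_len (Suc n). f h) = (\<Sum>(h,x)\<in>lists_len n \<times> UNIV. f (x # h))"
    by (rule sum.reindex_bij_witness[of _ "\<lambda>(h,x). x # h" "\<lambda>h. (tl h, hd h)"])
       (auto simp: lists_len_def length_Suc_conv)
  then show ?thesis by (simp add: sum.cartesian_product)
qed

lemma sum_pmf_UNIV: "(\<Sum>x\<in>UNIV. pmf p x) = 1" for p :: "'x::finite pmf"
  by (rule sum_pmf_eq_1) auto

text \<open>The marginal weight of the observation \<open>u\<close> at the value it takes in
  \<open>w\<close>, pulled back to the sample space. Quotients of such sums are conditional
  probabilities.\<close>

definition class_sum :: "'w set \<Rightarrow> ('w \<Rightarrow> real) \<Rightarrow> ('w \<Rightarrow> 'u) \<Rightarrow> 'w \<Rightarrow> real" where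
  "class_sum \<Omega> p u w = (\<Sum>g | g \<in> \<Omega> \<and> u g = u w. p g)"

lemma class_sum_cong: "u w = u w' \<Longrightarrow> class_sum \<Omega> p u w = class_sum \<Omega> p u w'"
  by (simp add: class_sum_def)

lemma class_sum_ge:
  assumes "finite \<Omega>" "\<And>w. w \<in> \<Omega> \<Longrightarrow> 0 \<le> p w" "w \<in> \<Omega>"
  shows "p w \<le> class_sum \<Omega> p u w"
  unfolding class_sum_def using assms by (intro member_le_sum) auto

lemma class_sum_pos:
  assumes "finite \<Omega>" "\<And>w. w \<in> \<Omega> \<Longrightarrow> 0 \<le> p w" "w \<in> \<Omega>" "0 < p w"
  shows "0 < class_sum \<Omega> p u w"
  using class_sum_ge[of \<Omega> p w u] assms by simp

lemma class_sum_nonneg: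
  assumes "\<And>w. w \<in> \<Omega> \<Longrightarrow> 0 \<le> p w"
  shows "0 \<le> class_sum \<Omega> p u w"
  unfolding class_sum_def using assms by (intro sum_nonneg) auto

text \<open>Conditioning on more cannot increase entropy: the log-likelihood of \<open>a\<close> given \<open>u\<close> dominates
  in mean that of \<open>a\<close> given any function \<open>v\<close> of \<open>u\<close>.\<close>

lemma conditional_gibbs:
  fixes u :: "'w \<Rightarrow> 'u" and v :: "'w \<Rightarrow> 'v" and a :: "'w \<Rightarrow> 'a"
  assumes fin: "finite \<Omega>" and p: "\<And>w. w \<in> \<Omega> \<Longrightarrow> 0 \<le> p w"
    and uv: "\<And>w w'. w \<in> \<Omega> \<Longrightarrow> w' \<in> \<Omega> \<Longrightarrow> u w = u w' \<Longrightarrow> v w = v w'"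
  defines "pu \<equiv> class_sum \<Omega> p u" and "pua \<equiv> class_sum \<Omega> p (\<lambda>w. (u w, a w))"
    and "pv \<equiv> class_sum \<Omega> p v" and "pva \<equiv> class_sum \<Omega> p (\<lambda>w. (v w, a w))"
  shows "(\<Sum>w\<in>\<Omega>. p w * ln (pva w / pv w)) \<le> (\<Sum>w\<in>\<Omega>. p w * ln (pua w / pu w))"
proof -
  define c where "c g x = (\<Sum>w | w \<in> \<Omega> \<and> v w = v g \<and> a w = x. p w)" for g x
  define d where "d g x = (\<Sum>w | w \<in> \<Omega> \<and> u w = u g \<and> a w = x. p w)" for g x
  have c0: "0 \<le> c g x" and d0: "0 \<le> d g x" for g x
    unfolding c_def d_def using p by (auto intro!: sum_nonneg)
  have pva: "pva w = c g (a w)" if "u w = u g" "w \<in> \<Omega>" "g \<in> \<Omega>" for w g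
    using uv[of w g] that unfolding pva_def class_sum_def c_def by simp
  have pua: "pua w = d g (a w)" if "u w = u g" for w g
    using that unfolding pua_def class_sum_def d_def by simp
  have pv: "pv w = pv g" if "u w = u g" "w \<in> \<Omega>" "g \<in> \<Omega>" for w g
    using uv[of w g] that unfolding pv_def by (auto intro: class_sum_cong)
  have pvc: "(\<Sum>x\<in>a ` \<Omega>. c g x) = pv g" for g
  proof -
    have "pv g = (\<Sum>x\<in>a ` \<Omega>. \<Sum>w | w \<in> {w \<in> \<Omega>. v w = v g} \<and> a w = x. p w)"
      unfolding pv_def class_sum_def using fin by (intro sum.group[symmetric]) auto
    then show ?thesis by (simp add: c_def conj_assoc)
  qed
  \<comment> \<open>Within one class of \<open>u\<close>, grouping by the value of \<open>a\<close>
    cancels \<open>d\<close> and leaves a sum of the conditional law \<open>c g x / pv g\<close>. It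
    may fall short of 1 because values of \<open>a\<close> that have no weight in the class drop
    out.\<close>
  have inner: "(\<Sum>w | w \<in> \<Omega> \<and> u w = u g. p w * (pva w / (pv w * pua w))) \<le> 1" if g: "g \<in> \<Omega>" for g
  proof -
    have "(\<Sum>w | w \<in> \<Omega> \<and> u w = u g. p w * (pva w / (pv w * pua w)))
       = (\<Sum>w | w \<in> \<Omega> \<and> u w = u g. p w * (c g (a w) / (pv g * d g (a w))))"
    proof (intro sum.cong refl)
      fix w assume "w \<in> {w \<in> \<Omega>. u w = u g}"
      then show "p w * (pva w / (pv w * pua w)) = p w * (c g (a w) / (pv g * d g (a w)))"
        using g pva[of w g] pua[of w g] pv[of w g] by simp
    qed
    also have "\<dots> = (\<Sum>x\<in>a ` \<Omega>. \<Sum>w | w \<in> {w \<in> \<Omega>. u w = u g} \<and> a w = x.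
        p w * (c g (a w) / (pv g * d g (a w))))"
      using fin by (intro sum.group[symmetric]) auto
    also have "\<dots> = (\<Sum>x\<in>a ` \<Omega>. \<Sum>w | w \<in> \<Omega> \<and> u w = u g \<and> a w = x.
        p w * (c g x / (pv g * d g x)))"
      by (intro sum.cong) auto
    also have "\<dots> = (\<Sum>x\<in>a ` \<Omega>. d g x * (c g x / (pv g * d g x)))"
      by (simp only: sum_distrib_right[symmetric] d_def)
    also have "\<dots> \<le> (\<Sum>x\<in>a ` \<Omega>. c g x / pv g)"
    proof (intro sum_mono)
      fix x
      have "0 \<le> pv g" unfolding pv_def by (rule class_sum_nonneg[OF p])
      then show "d g x * (c g x / (pv g * d g x)) \<le> c g x / pv g"
        using c0[of g x] by (cases "d g x = 0") auto
    qed
    also have "\<dots> \<le> 1" by (simp add: pvc sum_divide_distrib[symmetric])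
    finally show ?thesis .
  qed
  \<comment> \<open>\<open>pu w\<close> is expanded into the sum over its class and the two sums are
    swapped, so that \<open>inner\<close> applies class by class.\<close>
  have "(\<Sum>w\<in>\<Omega>. p w * (pva w * pu w / (pv w * pua w)))
      = (\<Sum>w\<in>\<Omega>. \<Sum>g | g \<in> \<Omega> \<and> u g = u w. p g * (p w * (pva w / (pv w * pua w))))"
    by (simp add: pu_def class_sum_def sum_distrib_left sum_distrib_right sum_divide_distrib mult_ac)
  also have "\<dots> = (\<Sum>g\<in>\<Omega>. \<Sum>w | w \<in> \<Omega> \<and> u w = u g. p g * (p w * (pva w / (pv w * pua w))))"
    using sum.swap_restrict[OF fin fin, of "\<lambda>w g. p g * (p w * (pva w / (pv w * pua w)))" "\<lambda>w g. u g = u w"]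
    by (simp add: eq_commute)
  also have "\<dots> = (\<Sum>g\<in>\<Omega>. p g * (\<Sum>w | w \<in> \<Omega> \<and> u w = u g. p w * (pva w / (pv w * pua w))))"
    by (simp add: sum_distrib_left)
  also have "\<dots> \<le> (\<Sum>g\<in>\<Omega>. p g * 1)"
    using inner p by (intro sum_mono mult_left_mono) auto
  finally have key: "(\<Sum>w\<in>\<Omega>. p w * (pva w * pu w / (pv w * pua w))) \<le> (\<Sum>w\<in>\<Omega>. p w)" by simp
  have "(\<Sum>w\<in>\<Omega>. p w * ln (pva w / pv w)) - (\<Sum>w\<in>\<Omega>. p w * ln (pua w / pu w))
      = (\<Sum>w\<in>\<Omega>. p w * (ln (pva w / pv w) - ln (pua w / pu w)))"
    by (simp add: sum_subtractf right_diff_distrib)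
  also have "\<dots> \<le> (\<Sum>w\<in>\<Omega>. p w * (pva w * pu w / (pv w * pua w)) - p w)"
  proof (intro sum_mono)
    fix w assume w: "w \<in> \<Omega>"
    show "p w * (ln (pva w / pv w) - ln (pua w / pu w)) \<le> p w * (pva w * pu w / (pv w * pua w)) - p w"
    proof (cases "p w = 0")
      case False
      then have pw: "0 < p w" using p[OF w] by simp
      have pos: "0 < pu w" "0 < pua w" "0 < pv w" "0 < pva w"
        unfolding pu_def pua_def pv_def pva_def using fin p w pw by (auto intro!: class_sum_pos)
      have "ln (pva w / pv w) - ln (pua w / pu w) = ln (pva w * pu w / (pv w * pua w))"
        using pos by (simp add: ln_div ln_mult)
      also have "\<dots> \<le> pva w * pu w / (pv w * pua w) - 1" using pos by (intro ln_le_minus_one) auto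
      finally have "p w * (ln (pva w / pv w) - ln (pua w / pu w)) \<le> p w * (pva w * pu w / (pv w * pua w) - 1)"
        by (rule mult_left_mono[OF _ p[OF w]])
      then show ?thesis by (simp add: right_diff_distrib)
    qed simp
  qed
  also have "\<dots> \<le> 0" using key by (simp add: sum_subtractf)
  finally show ?thesis by simp
qed

section \<open>Imagined histories\<close>

type_synonym ('n, 'st, 'ac) jstep = "('n \<Rightarrow> 'st) \<times> ('n \<Rightarrow> 'ac)"

definition proj_step :: "'n \<Rightarrow> ('n, 'st, 'ac) jstep \<Rightarrow> 'st \<times> 'ac" where
  "proj_step i x = (fst x i, snd x i)"

text \<open>What really happens when agent \<open>i\<close> samples a whole joint step
  \<open>z i\<close> and only its own component of it is carried out.\<close>

definition diag :: "('n \<Rightarrow> ('n, 'st, 'ac) jstep) \<Rightarrow> ('n, 'st, 'ac) jstep" where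
  "diag z = (\<lambda>i. fst (z i) i, \<lambda>i. snd (z i) i)"

lemma diag_eq_iff: "diag z = x \<longleftrightarrow> (\<forall>i. proj_step i (z i) = proj_step i x)"
  by (auto simp: diag_def proj_step_def prod_eq_iff fun_eq_iff)

text \<open>All histories and bit lists below run backwards in time. \<open>obs i bs h\<close> is what agent \<open>i\<close> knows
  of the joint history \<open>h\<close>: everything up to the latest communication, its own steps after it.\<close>

fun obs :: "'n \<Rightarrow> bool list \<Rightarrow> ('n, 'st, 'ac) jstep list
    \<Rightarrow> (('n, 'st, 'ac) jstep + 'st \<times> 'ac) list" where
  "obs i (b # bs) (x # h) = (if b then map Inl (x # h) else Inr (proj_step i x) # obs i bs h)"
| "obs i bs h = []"

lemma obs_True_eq_iff: "obs i (True # bs) (x # g) = obs i (True # bs) (y # h) \<longleftrightarrow> x = y \<and> g = h"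
  by (auto simp: inj_map_eq_map)

text \<open>What an agent knows without communication is a function of what it knows under any
  pattern \<open>bs\<close>. This is the refinement hypothesis of
  \<open>conditional_gibbs\<close>.\<close>

lemma obs_eq_imp_obs_replicate_eq:
  assumes "length bs = n" "length g = n" "length h = n" "obs i bs g = obs i bs h"
  shows "obs i (replicate n False) g = obs i (replicate n False) h"
  using assms
proof (induction bs arbitrary: n g h)
  case (Cons b bs)
  then obtain m x g' y h' where eq: "n = Suc m" "g = x # g'" "h = y # h'"
    by (metis length_Suc_conv)
  show ?case
  proof (cases b)
    case True
    then have "g = h" using Cons.prems obs_True_eq_iff eq by metis
    then show ?thesis by simp
  next
    case False
    then have *: "proj_step i x = proj_step i y" "obs i bs g' = obs i bs h'"
      using Cons.prems by (auto simp: eq)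
    from Cons.IH[of m g' h'] *(2) Cons.prems have "obs i (replicate m False) g' = obs i (replicate m False) h'"
      by (simp add: eq)
    with *(1) show ?thesis by (simp add: eq)
  qed
qed auto

text \<open>The full-communication probability of the observation that agent \<open>i\<close> makes
  of \<open>h\<close>; it normalizes the posterior of the imagined history.\<close>

definition obs_weight :: "('n, 'st::finite, 'ac::finite) jstep pmf \<Rightarrow> (('n::finite, 'st, 'ac) jstep \<Rightarrow> ('n, 'st, 'ac) jstep pmf)
    \<Rightarrow> 'n \<Rightarrow> bool list \<Rightarrow> ('n, 'st, 'ac) jstep list \<Rightarrow> real" where
  "obs_weight \<mu> K i bs h = class_sum (lists_len (length bs)) (path_weight \<mu> K) (obs i bs) h"

text \<open>The likelihood of a realized history given the bits, exact on the support of \<open>path_weight\<close>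
  (off it, the quotients may be \<open>0 / 0 = 0\<close>).\<close>

primrec lik :: "('n, 'st::finite, 'ac::finite) jstep pmf \<Rightarrow> (('n::finite, 'st, 'ac) jstep \<Rightarrow> ('n, 'st, 'ac) jstep pmf)
    \<Rightarrow> bool list \<Rightarrow> ('n, 'st, 'ac) jstep list \<Rightarrow> real" where
  "lik \<mu> K [] h = 1"
| "lik \<mu> K (b # bs) h = lik \<mu> K bs (tl h) *
     (if b then pmf (next_step \<mu> K (tl h)) (hd h)
      else \<Prod>i\<in>UNIV. obs_weight \<mu> K i (False # bs) h / obs_weight \<mu> K i bs (tl h))"

definition bits_weight :: "bool pmf \<Rightarrow> bool list \<Rightarrow> real" where
  "bits_weight \<nu> bs = prod_list (map (pmf \<nu>) bs)"

text \<open>The chain records the availability bits, the realized history and the history \<open>Y i\<close> that each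
  agent imagines. Letting the agents imagine whole histories rather than just the current state does
  not change the law, and makes the posterior of \<open>Y i\<close> a conditioned path law.\<close>

definition hist_step :: "('n, 'st::finite, 'ac::finite) jstep pmf \<Rightarrow> (('n::finite, 'st, 'ac) jstep \<Rightarrow> ('n, 'st, 'ac) jstep pmf)
    \<Rightarrow> bool list \<times> ('n, 'st, 'ac) jstep list \<times> ('n \<Rightarrow> ('n, 'st, 'ac) jstep list) \<Rightarrow> bool
    \<Rightarrow> (bool list \<times> ('n, 'st, 'ac) jstep list \<times> ('n \<Rightarrow> ('n, 'st, 'ac) jstep list)) pmf" where
  "hist_step \<mu> K w b = (case w of (bs, h, Y) \<Rightarrow>
     if b then map_pmf (\<lambda>x. (True # bs, x # h, \<lambda>_. x # h)) (next_step \<mu> K h)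
     else map_pmf (\<lambda>z. (False # bs, diag z # h, \<lambda>i. z i # Y i))
       (Pi_pmf UNIV undefined (\<lambda>i. next_step \<mu> K (Y i))))"

primrec hist :: "bool pmf \<Rightarrow> ('n, 'st::finite, 'ac::finite) jstep pmf \<Rightarrow> (('n::finite, 'st, 'ac) jstep \<Rightarrow> ('n, 'st, 'ac) jstep pmf)
    \<Rightarrow> nat \<Rightarrow> (bool list \<times> ('n, 'st, 'ac) jstep list \<times> ('n \<Rightarrow> ('n, 'st, 'ac) jstep list)) pmf" where
  "hist \<nu> \<mu> K 0 = return_pmf ([], [], \<lambda>_. [])"
| "hist \<nu> \<mu> K (Suc n) = bind_pmf (hist \<nu> \<mu> K n) (\<lambda>w. bind_pmf \<nu> (hist_step \<mu> K w))"

lemma set_pmf_hist: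
  assumes "(bs, h, Y) \<in> set_pmf (hist \<nu> \<mu> K n)"
  shows "length bs = n" "length h = n" "length (Y i) = n"
    and "n > 0 \<Longrightarrow> hd h = diag (\<lambda>i. hd (Y i))"
proof -
  have "length bs = n \<and> length h = n \<and> (\<forall>i. length (Y i) = n) \<and> (n > 0 \<longrightarrow> hd h = diag (\<lambda>i. hd (Y i)))"
    using assms
  proof (induction n arbitrary: bs h Y)
    case (Suc n)
    then obtain bs' h' Y' b where w: "(bs', h', Y') \<in> set_pmf (hist \<nu> \<mu> K n)"
      and s: "(bs, h, Y) \<in> set_pmf (hist_step \<mu> K (bs', h', Y') b)" by auto
    have "length bs' = n" "length h' = n" "\<And>i. length (Y' i) = n" using Suc.IH[OF w] by auto
    with s show ?case by (auto simp: hist_step_def diag_def split: if_splits)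
  qed auto
  then show "length bs = n" "length h = n" "length (Y i) = n"
    "n > 0 \<Longrightarrow> hd h = diag (\<lambda>i. hd (Y i))" by auto
qed

text \<open>The drawn bit is recorded in the new state, so only one branch of the mixture over
  \<open>\<nu>\<close> can lead there.\<close>

lemma pmf_bind_hist_step:
  "pmf (bind_pmf \<nu> (hist_step \<mu> K w)) (b # bs, u) = pmf \<nu> b * pmf (hist_step \<mu> K w b) (b # bs, u)"
proof -
  have zero: "pmf (hist_step \<mu> K w c) (b # bs, u) = 0" if "c \<noteq> b" for c
    using that by (cases c) (auto simp: hist_step_def pmf_eq_0_set_pmf split: prod.splits)
  have "(\<integral>c. pmf (hist_step \<mu> K w c) (b # bs, u) \<partial>measure_pmf \<nu>)
      = (\<Sum>c\<in>{b}. pmf (hist_step \<mu> K w c) (b # bs, u) * pmf \<nu> c)"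
  proof (intro integral_measure_pmf_real)
    fix c assume "pmf (hist_step \<mu> K w c) (b # bs, u) \<noteq> 0"
    then show "c \<in> {b}" using zero by blast
  qed simp
  then show ?thesis by (simp add: pmf_bind)
qed

lemma pmf_hist_step_True:
  "pmf (hist_step \<mu> K (bs', h', Y') True) (True # bs, x # h, Y)
     = (if bs' = bs \<and> h' = h \<and> Y = (\<lambda>_. x # h) then pmf (next_step \<mu> K h) x else 0)"
proof (cases "bs' = bs \<and> h' = h \<and> Y = (\<lambda>_. x # h)")
  case True
  have "inj (\<lambda>x. (True # bs, x # h, \<lambda>_::'a. x # h))" by (auto simp: inj_def)
  from pmf_map_inj'[OF this] True show ?thesis by (simp add: hist_step_def)
next
  case False
  then show ?thesis by (auto simp: hist_step_def pmf_eq_0_set_pmf)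
qed

lemma pmf_hist_step_False:
  "pmf (hist_step \<mu> K (bs', h', Y') False) (False # bs, x # h, \<lambda>i. z i # Y i)
     = (if bs' = bs \<and> h' = h \<and> Y' = Y \<and> diag z = x
        then \<Prod>i\<in>UNIV. pmf (next_step \<mu> K (Y i)) (z i) else 0)"
proof (cases "bs' = bs \<and> h' = h \<and> Y' = Y \<and> diag z = x")
  case True
  have "inj (\<lambda>z. (False # bs, diag z # h, \<lambda>i. z i # Y i))" by (auto simp: inj_def fun_eq_iff)
  from pmf_map_inj'[OF this, of _ z] True show ?thesis by (simp add: hist_step_def pmf_Pi)
next
  case False
  have inj: "z = z' \<and> Y = Y'" if "(\<lambda>i. z i # Y i) = (\<lambda>i. z' i # Y' i)" for z'
    using that by (auto simp: fun_eq_iff)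
  from False show ?thesis by (auto simp: hist_step_def pmf_eq_0_set_pmf dest!: inj)
qed

lemma obs_weight_ge: "length h = length bs \<Longrightarrow> path_weight \<mu> K h \<le> obs_weight \<mu> K i bs h"
  unfolding obs_weight_def by (rule class_sum_ge) auto

lemma obs_weight_True:
  assumes "length h = length bs"
  shows "obs_weight \<mu> K i (True # bs) (x # h) = path_weight \<mu> K (x # h)"
proof -
  have "{g \<in> lists_len (length (True # bs)). obs i (True # bs) g = obs i (True # bs) (x # h)} = {x # h}"
    using assms obs_True_eq_iff by (auto simp: length_Suc_conv inj_map_eq_map)
  then show ?thesis unfolding obs_weight_def class_sum_def by simp
qed

lemma path_weight_ConsD: "0 < path_weight \<mu> K (x # h) \<Longrightarrow> 0 < path_weight \<mu> K h"
  by (metis less_eq_real_def mult_zero_left path_weight.simps(2) path_weight_nonneg)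

text \<open>Given the realized history, the agents' imagined histories are independent, and that of
  agent \<open>i\<close> is a full-communication path conditioned on what \<open>i\<close> has observed.\<close>

lemma pmf_hist:
  assumes "0 < path_weight \<mu> K h" "length h = n" "length bs = n" "\<And>i. length (Y i) = n"
  shows "pmf (hist \<nu> \<mu> K n) (bs, h, Y) = bits_weight \<nu> bs * lik \<mu> K bs h *
    (\<Prod>i\<in>UNIV. if obs i bs (Y i) = obs i bs h then path_weight \<mu> K (Y i) / obs_weight \<mu> K i bs h else 0)"
  using assms
proof (induction n arbitrary: bs h Y)
  case 0
  have "Y = (\<lambda>_. [])" using "0.prems" by auto
  moreover have "obs_weight \<mu> K i [] [] = 1" for i
    by (simp add: obs_weight_def class_sum_def)
  ultimately show ?case using "0.prems" by (simp add: bits_weight_def)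
next
  case (Suc n)
  obtain b bs' x h' where eq: "bs = b # bs'" "h = x # h'" and len: "length bs' = n" "length h' = n"
    using Suc.prems by (metis length_Suc_conv)
  define z where "z i = hd (Y i)" for i
  define Y' where "Y' i = tl (Y i)" for i
  have Yi: "Y i = z i # Y' i" and Y'len: "length (Y' i) = n" for i
    using Suc.prems(4)[of i] by (auto simp: z_def Y'_def length_Suc_conv)
  then have Y: "Y = (\<lambda>i. z i # Y' i)" by auto
  have posx: "0 < path_weight \<mu> K (x # h')" using Suc.prems eq by simp
  then have pos: "0 < path_weight \<mu> K h'" by (rule path_weight_ConsD)
  note IH = Suc.IH[OF pos len(2) len(1)]
  \<comment> \<open>Positivity of \<open>h\<close> under full communication keeps all normalizers
    away from 0, so the quotients below cancel.\<close>
  have Qpos: "0 < obs_weight \<mu> K i bs' h'" for i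
    using obs_weight_ge[of h' bs' \<mu> K i] len pos by simp
  have Qpos': "0 < obs_weight \<mu> K i (c # bs') (x # h')" for i c
    using obs_weight_ge[of "x # h'" "c # bs'" \<mu> K i] len posx by simp
  let ?f = "\<lambda>w. pmf \<nu> b * pmf (hist_step \<mu> K w b) (b # bs', x # h', Y)"
  have "pmf (hist \<nu> \<mu> K (Suc n)) (bs, h, Y) = (\<integral>w. ?f w \<partial>measure_pmf (hist \<nu> \<mu> K n))"
    by (simp add: pmf_bind[of "hist \<nu> \<mu> K n"] pmf_bind_hist_step eq)
  also have "\<dots> = bits_weight \<nu> bs * lik \<mu> K bs h *
    (\<Prod>i\<in>UNIV. if obs i bs (Y i) = obs i bs h then path_weight \<mu> K (Y i) / obs_weight \<mu> K i bs h else 0)"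
  proof (cases b)
    case False
    \<comment> \<open>Without communication the predecessor is determined: each of the lists loses
      its latest entry.\<close>
    have "(\<integral>w. ?f w \<partial>measure_pmf (hist \<nu> \<mu> K n)) = (\<Sum>w\<in>{(bs', h', Y')}. ?f w * pmf (hist \<nu> \<mu> K n) w)"
      using False by (intro integral_measure_pmf_real) (auto simp: Y pmf_hist_step_False split: if_splits)
    also have "\<dots> = (if diag z = x then pmf \<nu> b * (\<Prod>i\<in>UNIV. pmf (next_step \<mu> K (Y' i)) (z i)) else 0)
        * (bits_weight \<nu> bs' * lik \<mu> K bs' h' *
      (\<Prod>i\<in>UNIV. if obs i bs' (Y' i) = obs i bs' h' then path_weight \<mu> K (Y' i) / obs_weight \<mu> K i bs' h' else 0))"
      using False Y'len by (simp add: Y pmf_hist_step_False IH)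
    also have "\<dots> = bits_weight \<nu> bs * (lik \<mu> K bs' h' * (if diag z = x then
      (\<Prod>i\<in>UNIV. if obs i bs' (Y' i) = obs i bs' h' then path_weight \<mu> K (Y i) / obs_weight \<mu> K i bs' h' else 0) else 0))"
      by (auto simp: bits_weight_def eq Yi prod.distrib[symmetric] intro!: prod.cong)
    \<comment> \<open>\<open>diag z = x\<close> means that every agent's own component agrees with
      \<open>x\<close>, which is what the newest entry of \<open>obs\<close> tests.\<close>
    also have "(if diag z = x then
      (\<Prod>i\<in>UNIV. if obs i bs' (Y' i) = obs i bs' h' then path_weight \<mu> K (Y i) / obs_weight \<mu> K i bs' h' else 0) else 0)
      = (\<Prod>i\<in>UNIV. if obs i bs (Y i) = obs i bs h then path_weight \<mu> K (Y i) / obs_weight \<mu> K i bs' h' else 0)"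
    proof (cases "diag z = x")
      case True
      then have "proj_step i (z i) = proj_step i x" for i by (simp add: diag_eq_iff)
      then show ?thesis using True False by (auto simp: eq Yi intro!: prod.cong)
    next
      case diag: False
      then obtain i where "proj_step i (z i) \<noteq> proj_step i x" by (auto simp: diag_eq_iff)
      then have "(\<Prod>i\<in>UNIV. if obs i bs (Y i) = obs i bs h then path_weight \<mu> K (Y i) / obs_weight \<mu> K i bs' h' else 0) = 0"
        using False by (intro prod_zero) (auto simp: eq Yi intro!: exI[of _ i])
      then show ?thesis using diag by simp
    qed
    \<comment> \<open>Passing from the old normalizers to the new ones costs exactly the quotients
      that \<open>lik\<close> gains at a lost step.\<close>
    also have "lik \<mu> K bs' h' * \<dots> = lik \<mu> K bs h *
      (\<Prod>i\<in>UNIV. if obs i bs (Y i) = obs i bs h then path_weight \<mu> K (Y i) / obs_weight \<mu> K i bs h else 0)"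
    proof -
      have "obs_weight \<mu> K i (False # bs') (x # h') \<noteq> 0" for i using Qpos'[of i False] by simp
      then show ?thesis using False
        by (auto simp: eq mult.assoc prod.distrib[symmetric] intro!: prod.cong)
    qed
    finally show ?thesis by (simp add: mult.assoc)
  next
    case True
    define \<Y> :: "('a \<Rightarrow> ('a, 'b, 'c) jstep list) set" where "\<Y> = PiE UNIV (\<lambda>_. lists_len n)"
    have fin: "finite \<Y>" unfolding \<Y>_def by (intro finite_PiE) auto
    have mem: "V \<in> \<Y> \<longleftrightarrow> (\<forall>i. length (V i) = n)" for V by (auto simp: \<Y>_def PiE_iff)
    \<comment> \<open>A communication overwrites the imagined histories, so every previous family
      \<open>V\<close> contributes. The posterior is a product of probability laws, and summing it
      over all \<open>V\<close> gives 1.\<close>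
    have "(\<integral>w. ?f w \<partial>measure_pmf (hist \<nu> \<mu> K n)) = (\<Sum>w\<in>{bs'} \<times> {h'} \<times> \<Y>. ?f w * pmf (hist \<nu> \<mu> K n) w)"
      using True fin by (intro integral_measure_pmf_real)
        (auto simp: pmf_hist_step_True mem split: if_splits dest: set_pmf_hist(3))
    also have "\<dots> = (\<Sum>V\<in>\<Y>. ?f (bs', h', V) * pmf (hist \<nu> \<mu> K n) (bs', h', V))"
      by (simp add: sum.cartesian_product')
    also have "\<dots> = (\<Sum>V\<in>\<Y>. (if Y = (\<lambda>_. x # h') then pmf \<nu> b * pmf (next_step \<mu> K h') x else 0)
        * (bits_weight \<nu> bs' * lik \<mu> K bs' h' *
      (\<Prod>i\<in>UNIV. if obs i bs' (V i) = obs i bs' h' then path_weight \<mu> K (V i) / obs_weight \<mu> K i bs' h' else 0)))"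
      using True by (intro sum.cong refl) (auto simp: pmf_hist_step_True IH mem)
    also have "\<dots> = (if Y = (\<lambda>_. x # h') then pmf \<nu> b * pmf (next_step \<mu> K h') x else 0)
        * (bits_weight \<nu> bs' * lik \<mu> K bs' h' * (\<Sum>V\<in>\<Y>.
      (\<Prod>i\<in>UNIV. if obs i bs' (V i) = obs i bs' h' then path_weight \<mu> K (V i) / obs_weight \<mu> K i bs' h' else 0)))"
      by (simp only: sum_distrib_left)
    also have "(\<Sum>V\<in>\<Y>.
      (\<Prod>i\<in>UNIV. if obs i bs' (V i) = obs i bs' h' then path_weight \<mu> K (V i) / obs_weight \<mu> K i bs' h' else 0))
      = (\<Prod>i\<in>UNIV. \<Sum>g\<in>lists_len n. if obs i bs' g = obs i bs' h' then path_weight \<mu> K g / obs_weight \<mu> K i bs' h' else 0)"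
      unfolding \<Y>_def by (rule prod_sum_PiE[symmetric]) auto
    also have "\<dots> = (\<Prod>i\<in>(UNIV::'a set). 1)"
    proof (intro prod.cong refl)
      fix i :: 'a
      show "(\<Sum>g\<in>lists_len n. if obs i bs' g = obs i bs' h' then path_weight \<mu> K g / obs_weight \<mu> K i bs' h' else 0) = 1"
        using Qpos[of i] len
        by (simp add: sum.inter_filter[symmetric] sum_divide_distrib[symmetric] obs_weight_def class_sum_def)
    qed
    also have "(if Y = (\<lambda>_. x # h') then pmf \<nu> b * pmf (next_step \<mu> K h') x else 0)
        * (bits_weight \<nu> bs' * lik \<mu> K bs' h' * (\<Prod>i\<in>(UNIV::'a set). 1))
       = bits_weight \<nu> bs * lik \<mu> K bs h * (if Y = (\<lambda>_. x # h') then 1 else 0)"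
      using True by (simp add: eq bits_weight_def)
    \<comment> \<open>Right after a communication the posterior of each imagined history is the
      point mass at the real one.\<close>
    also have "(if Y = (\<lambda>_. x # h') then 1 else 0) =
      (\<Prod>i\<in>UNIV. if obs i bs (Y i) = obs i bs h then path_weight \<mu> K (Y i) / obs_weight \<mu> K i bs h else 0)"
    proof (cases "Y = (\<lambda>_. x # h')")
      case eqY: True
      then show ?thesis using posx len True by (simp add: eq obs_weight_True del: path_weight.simps)
    next
      case neq: False
      then obtain i where "Y i \<noteq> x # h'" by auto
      then have "obs i bs (Y i) \<noteq> obs i bs h" using True by (auto simp: eq Yi inj_map_eq_map)
      then have "(\<Prod>i\<in>UNIV. if obs i bs (Y i) = obs i bs h then path_weight \<mu> K (Y i) / obs_weight \<mu> K i bs h else 0) = 0"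
        by (intro prod_zero) (auto intro!: exI[of _ i])
      then show ?thesis using neq by simp
    qed
    finally show ?thesis .
  qed
  finally show ?case .
qed

text \<open>For fixed bits the posteriors of the imagined histories sum to 1, which leaves the
  likelihood mixed over the bits.\<close>

lemma pmf_realized_history:
  assumes pos: "0 < path_weight \<mu> K h" and len: "length h = n"
  shows "pmf (map_pmf (\<lambda>(bs, h, Y). h) (hist \<nu> \<mu> K n)) h
    = (\<Sum>bs\<in>lists_len n. bits_weight \<nu> bs * lik \<mu> K bs h)"
proof -
  define \<Y> :: "('a \<Rightarrow> ('a, 'b, 'c) jstep list) set" where "\<Y> = PiE UNIV (\<lambda>_. lists_len n)"
  have fin: "finite \<Y>" unfolding \<Y>_def by (intro finite_PiE) auto
  have mem: "V \<in> \<Y> \<longleftrightarrow> (\<forall>i. length (V i) = n)" for V by (auto simp: \<Y>_def PiE_iff)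
  have "pmf (map_pmf (\<lambda>(bs, h, Y). h) (hist \<nu> \<mu> K n)) h
     = (\<integral>w. indicator {h} (fst (snd w)) \<partial>measure_pmf (hist \<nu> \<mu> K n))"
    by (simp add: map_pmf_def pmf_bind split_beta indicator_def eq_commute)
  also have "\<dots> = (\<Sum>w\<in>lists_len n \<times> {h} \<times> \<Y>. indicator {h} (fst (snd w)) * pmf (hist \<nu> \<mu> K n) w)"
    using fin by (intro integral_measure_pmf_real)
      (auto simp: mem indicator_def dest: set_pmf_hist split: if_splits)
  also have "\<dots> = (\<Sum>bs\<in>lists_len n. \<Sum>V\<in>\<Y>. pmf (hist \<nu> \<mu> K n) (bs, h, V))"
    by (simp add: sum.cartesian_product')
  also have "\<dots> = (\<Sum>bs\<in>lists_len n. bits_weight \<nu> bs * lik \<mu> K bs h)"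
  proof (intro sum.cong refl)
    fix bs :: "bool list" assume "bs \<in> lists_len n"
    then have bs: "length bs = n" by simp
    have "(\<Sum>V\<in>\<Y>. pmf (hist \<nu> \<mu> K n) (bs, h, V)) = bits_weight \<nu> bs * lik \<mu> K bs h * (\<Sum>V\<in>\<Y>.
      (\<Prod>i\<in>UNIV. if obs i bs (V i) = obs i bs h then path_weight \<mu> K (V i) / obs_weight \<mu> K i bs h else 0))"
      by (simp add: pmf_hist[OF pos len bs] mem sum_distrib_left)
    also have "(\<Sum>V\<in>\<Y>.
      (\<Prod>i\<in>UNIV. if obs i bs (V i) = obs i bs h then path_weight \<mu> K (V i) / obs_weight \<mu> K i bs h else 0))
      = (\<Prod>i\<in>UNIV. \<Sum>g\<in>lists_len n. if obs i bs g = obs i bs h then path_weight \<mu> K g / obs_weight \<mu> K i bs h else 0)"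
      unfolding \<Y>_def by (rule prod_sum_PiE[symmetric]) auto
    also have "\<dots> = (\<Prod>i\<in>(UNIV::'a set). 1)"
    proof (intro prod.cong refl)
      fix i :: 'a
      have "0 < obs_weight \<mu> K i bs h"
        using obs_weight_ge[of h bs \<mu> K i] len bs pos by simp
      then show "(\<Sum>g\<in>lists_len n. if obs i bs g = obs i bs h then path_weight \<mu> K g / obs_weight \<mu> K i bs h else 0) = 1"
        using len bs by (simp add: sum.inter_filter[symmetric] sum_divide_distrib[symmetric] obs_weight_def class_sum_def)
    qed
    finally show "(\<Sum>V\<in>\<Y>. pmf (hist \<nu> \<mu> K n) (bs, h, V)) = bits_weight \<nu> bs * lik \<mu> K bs h" by simp
  qed
  finally show ?thesis .
qed

section \<open>Divergence of prefixes\<close>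

text \<open>A path possible under full communication stays possible under every bit pattern, because
  the observation class of \<open>h\<close> contains \<open>h\<close> itself. This keeps the
  logarithms below meaningful.\<close>

lemma lik_pos:
  assumes "0 < path_weight \<mu> K h" "length h = length bs"
  shows "0 < lik \<mu> K bs h"
  using assms
proof (induction bs arbitrary: h)
  case (Cons b bs)
  then obtain x t where h: "h = x # t" by (cases h) auto
  have pt: "0 < path_weight \<mu> K t" using Cons.prems(1) h by (metis path_weight_ConsD)
  have "0 < obs_weight \<mu> K i (False # bs) h" "0 < obs_weight \<mu> K i bs t" for i
    using obs_weight_ge[of h "False # bs" \<mu> K i] obs_weight_ge[of t bs \<mu> K i] Cons.prems pt h by auto
  then have "0 < (\<Prod>i\<in>UNIV. obs_weight \<mu> K i (False # bs) h / obs_weight \<mu> K i bs t)"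
    by (intro prod_pos) auto
  moreover have "0 < pmf (next_step \<mu> K t) x"
    using Cons.prems(1) pt h by (simp add: zero_less_mult_iff)
  moreover have "0 < lik \<mu> K bs t" using Cons pt h by auto
  ultimately show ?case by (simp add: h)
qed simp

text \<open>The divergence of the full-communication law of prefixes from the realized law under
  fixed bits. Values of \<open>lik\<close> off the support are multiplied by 0.\<close>

definition log_ratio :: "('n, 'st::finite, 'ac::finite) jstep pmf \<Rightarrow> (('n::finite, 'st, 'ac) jstep \<Rightarrow> ('n, 'st, 'ac) jstep pmf)
    \<Rightarrow> bool list \<Rightarrow> real" where
  "log_ratio \<mu> K bs = (\<Sum>h\<in>lists_len (length bs). path_weight \<mu> K h * ln (path_weight \<mu> K h / lik \<mu> K bs h))"

text \<open>A conditional total correlation: the true law of the next joint step against the product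
  of the agents' predictive laws of their own parts, each given what that agent observes under
  \<open>bs\<close>.\<close>

definition loss_cost :: "('n, 'st::finite, 'ac::finite) jstep pmf \<Rightarrow> (('n::finite, 'st, 'ac) jstep \<Rightarrow> ('n, 'st, 'ac) jstep pmf)
    \<Rightarrow> bool list \<Rightarrow> real" where
  "loss_cost \<mu> K bs = (\<Sum>h\<in>lists_len (Suc (length bs)). path_weight \<mu> K h *
     (ln (pmf (next_step \<mu> K (tl h)) (hd h))
      - (\<Sum>i\<in>UNIV. ln (obs_weight \<mu> K i (False # bs) h / obs_weight \<mu> K i bs (tl h)))))"

text \<open>The factor of the newest step cancels in the ratio, and its weights sum to 1.\<close>

lemma log_ratio_True: "log_ratio \<mu> K (True # bs) = log_ratio \<mu> K bs"
proof -
  have "path_weight \<mu> K (x # h) * ln (path_weight \<mu> K (x # h) / lik \<mu> K (True # bs) (x # h))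
     = path_weight \<mu> K h * ln (path_weight \<mu> K h / lik \<mu> K bs h) * pmf (next_step \<mu> K h) x" for x h
    by (cases "pmf (next_step \<mu> K h) x = 0") auto
  then show ?thesis
    unfolding log_ratio_def
    by (simp add: sum_lists_len_Suc sum_distrib_left[symmetric] sum_pmf_UNIV del: path_weight.simps lik.simps)
qed

text \<open>The chain rule of relative entropy for one lost step.\<close>

lemma log_ratio_False: "log_ratio \<mu> K (False # bs) = log_ratio \<mu> K bs + loss_cost \<mu> K bs"
proof -
  let ?c = "\<lambda>h. ln (pmf (next_step \<mu> K (tl h)) (hd h))
      - (\<Sum>i\<in>UNIV. ln (obs_weight \<mu> K i (False # bs) h / obs_weight \<mu> K i bs (tl h)))"
  have *: "path_weight \<mu> K (x # h) * ln (path_weight \<mu> K (x # h) / lik \<mu> K (False # bs) (x # h))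
     = path_weight \<mu> K h * ln (path_weight \<mu> K h / lik \<mu> K bs h) * pmf (next_step \<mu> K h) x
       + path_weight \<mu> K (x # h) * ?c (x # h)" if len: "h \<in> lists_len (length bs)" for x h
  proof (cases "path_weight \<mu> K (x # h) = 0")
    case True
    then show ?thesis by auto
  next
    case False
    then have pos: "0 < path_weight \<mu> K (x # h)" using path_weight_nonneg[of \<mu> K "x # h"] by linarith
    then have pt: "0 < path_weight \<mu> K h" by (rule path_weight_ConsD)
    then have px: "0 < pmf (next_step \<mu> K h) x" using pos by (simp add: zero_less_mult_iff)
    have q: "0 < obs_weight \<mu> K i (False # bs) (x # h)" "0 < obs_weight \<mu> K i bs h" for i
      using obs_weight_ge[of "x # h" "False # bs" \<mu> K i] obs_weight_ge[of h bs \<mu> K i] len pos pt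
      by (auto simp del: path_weight.simps)
    have l: "0 < lik \<mu> K bs h" using lik_pos[OF pt] len by simp
    let ?P = "\<Prod>i\<in>UNIV. obs_weight \<mu> K i (False # bs) (x # h) / obs_weight \<mu> K i bs h"
    have P: "0 < ?P" using q by (intro prod_pos) auto
    have lnP: "ln ?P = (\<Sum>i\<in>UNIV. ln (obs_weight \<mu> K i (False # bs) (x # h) / obs_weight \<mu> K i bs h))"
    proof (intro ln_prod)
      show "obs_weight \<mu> K i (False # bs) (x # h) / obs_weight \<mu> K i bs h \<noteq> 0" for i
        using q[of i] by simp
    qed simp
    have ratio: "ln (path_weight \<mu> K (x # h) / lik \<mu> K (False # bs) (x # h))
       = ln (path_weight \<mu> K h / lik \<mu> K bs h) + (ln (pmf (next_step \<mu> K h) x) - ln ?P)"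
    proof -
      have "ln (a * b / (c * d)) = ln (a / c) + (ln b - ln d)"
        if "0 < a" "0 < b" "0 < c" "0 < d" for a b c d :: real
        using that by (simp add: ln_div ln_mult)
      from this[OF pt px l P] show ?thesis by (simp only: path_weight.simps lik.simps list.sel if_False)
    qed
    show ?thesis unfolding ratio lnP list.sel by (simp add: algebra_simps)
  qed
  show ?thesis
    unfolding log_ratio_def loss_cost_def
    by (simp add: sum_lists_len_Suc * sum.distrib sum_distrib_left[symmetric] sum_pmf_UNIV
        del: path_weight.simps lik.simps)
qed

text \<open>A condition on \<open>tl w\<close> leaves the newest step free, and its law sums to 1.
  Thus numerator and denominator of a predictive quotient can be taken on one sample space.\<close>

lemma class_sum_tl:
  "class_sum (lists_len (Suc n)) (path_weight \<mu> K) (\<lambda>w. f (tl w)) w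
     = class_sum (lists_len n) (path_weight \<mu> K) f (tl w)"
  for \<mu> :: "'x::finite pmf"
proof -
  have "(\<Sum>x\<in>UNIV. if f h = f (tl w) then path_weight \<mu> K (x # h) else 0)
      = (if f h = f (tl w) then path_weight \<mu> K h else 0)" for h
    by (simp add: sum_distrib_left[symmetric] sum_pmf_UNIV)
  then show ?thesis
    unfolding class_sum_def sum.inter_filter[OF finite_lists_len] sum_lists_len_Suc list.sel by simp
qed

text \<open>Only the predictive terms depend on \<open>bs\<close>. For each agent,
  \<open>conditional_gibbs\<close> is used with \<open>u\<close> the observation under
  \<open>bs\<close>, \<open>v\<close> the one without communication and \<open>a\<close> the agent's
  own next step: knowing more raises the mean predictive log-likelihood and so lowers the
  cost.\<close>

lemma loss_cost_le: "loss_cost \<mu> K bs \<le> loss_cost \<mu> K (replicate (length bs) False)"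
proof -
  define n where "n = length bs"
  let ?o = "replicate n False"
  let ?\<Omega> = "lists_len (Suc n)" and ?p = "path_weight \<mu> K"
  have fac: "obs_weight \<mu> K i cs (tl w) = class_sum ?\<Omega> ?p (\<lambda>w. obs i cs (tl w)) w"
    "obs_weight \<mu> K i (False # cs) w = class_sum ?\<Omega> ?p (\<lambda>w. (obs i cs (tl w), proj_step i (hd w))) w"
    if cs: "length cs = n" and w0: "w \<in> ?\<Omega>" for i cs w
  proof -
    show "obs_weight \<mu> K i cs (tl w) = class_sum ?\<Omega> ?p (\<lambda>w. obs i cs (tl w)) w"
      using cs by (simp add: obs_weight_def class_sum_tl)
    obtain y t where w: "w = y # t" using w0 by (cases w) auto
    have "(obs i (False # cs) g = obs i (False # cs) w)
        \<longleftrightarrow> (obs i cs (tl g), proj_step i (hd g)) = (obs i cs (tl w), proj_step i (hd w))"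
      if "g \<in> ?\<Omega>" for g using that w by (cases g) auto
    then have "{g. g \<in> ?\<Omega> \<and> obs i (False # cs) g = obs i (False # cs) w}
      = {g. g \<in> ?\<Omega> \<and> (obs i cs (tl g), proj_step i (hd g)) = (obs i cs (tl w), proj_step i (hd w))}"
      by blast
    then show "obs_weight \<mu> K i (False # cs) w = class_sum ?\<Omega> ?p (\<lambda>w. (obs i cs (tl w), proj_step i (hd w))) w"
      using cs unfolding obs_weight_def class_sum_def by (simp only: length_Cons)
  qed
  have gibbs: "(\<Sum>w\<in>?\<Omega>. ?p w * ln (obs_weight \<mu> K i (False # ?o) w / obs_weight \<mu> K i ?o (tl w)))
      \<le> (\<Sum>w\<in>?\<Omega>. ?p w * ln (obs_weight \<mu> K i (False # bs) w / obs_weight \<mu> K i bs (tl w)))" for i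
  proof -
    have "(\<Sum>w\<in>?\<Omega>. ?p w * ln (class_sum ?\<Omega> ?p (\<lambda>w. (obs i ?o (tl w), proj_step i (hd w))) w
           / class_sum ?\<Omega> ?p (\<lambda>w. obs i ?o (tl w)) w))
      \<le> (\<Sum>w\<in>?\<Omega>. ?p w * ln (class_sum ?\<Omega> ?p (\<lambda>w. (obs i bs (tl w), proj_step i (hd w))) w
           / class_sum ?\<Omega> ?p (\<lambda>w. obs i bs (tl w)) w))"
      by (rule conditional_gibbs) (auto simp: n_def intro: obs_eq_imp_obs_replicate_eq)
    then show ?thesis by (simp add: fac n_def[symmetric])
  qed
  have "(\<Sum>i\<in>UNIV. \<Sum>w\<in>?\<Omega>. ?p w * ln (obs_weight \<mu> K i (False # ?o) w / obs_weight \<mu> K i ?o (tl w)))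
      \<le> (\<Sum>i\<in>UNIV. \<Sum>w\<in>?\<Omega>. ?p w * ln (obs_weight \<mu> K i (False # bs) w / obs_weight \<mu> K i bs (tl w)))"
    by (intro sum_mono gibbs)
  then have "(\<Sum>w\<in>?\<Omega>. ?p w * (\<Sum>i\<in>UNIV. ln (obs_weight \<mu> K i (False # ?o) w / obs_weight \<mu> K i ?o (tl w))))
      \<le> (\<Sum>w\<in>?\<Omega>. ?p w * (\<Sum>i\<in>UNIV. ln (obs_weight \<mu> K i (False # bs) w / obs_weight \<mu> K i bs (tl w))))"
    by (simp only: sum.swap[of _ _ ?\<Omega>] sum_distrib_left)
  then show ?thesis
    unfolding loss_cost_def n_def[symmetric]
    by (simp add: right_diff_distrib sum_subtractf n_def[symmetric])
qed

section \<open>Averaging over the availability bits\<close>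

lemma sum_bits_weight: "(\<Sum>bs\<in>lists_len n. bits_weight \<nu> bs) = 1"
proof (induction n)
  case (Suc n)
  have "pmf \<nu> True + pmf \<nu> False = 1" using sum_pmf_UNIV[of \<nu>] by (simp add: UNIV_bool)
  then show ?case using Suc
    by (simp add: sum_lists_len_Suc bits_weight_def UNIV_bool sum.distrib sum_distrib_left[symmetric]
        distrib_right[symmetric] add.commute)
qed (simp add: bits_weight_def)

lemma bits_weight_nonneg [simp]: "0 \<le> bits_weight \<nu> bs"
  unfolding bits_weight_def by (induction bs) auto

text \<open>The newest bit is independent of the earlier ones, so in mean a step adds
  \<open>pmf \<nu> False\<close> times its cost. Bounded by their values without any communication,
  these costs telescope to the log-ratio of the all-\<open>False\<close> pattern.\<close>

lemma mean_log_ratio_le: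
  "(\<Sum>bs\<in>lists_len n. bits_weight \<nu> bs * log_ratio \<mu> K bs)
     \<le> pmf \<nu> False * log_ratio \<mu> K (replicate n False)"
proof (induction n)
  case 0
  show ?case by (simp add: log_ratio_def bits_weight_def)
next
  case (Suc n)
  have one: "pmf \<nu> True + pmf \<nu> False = 1" using sum_pmf_UNIV[of \<nu>] by (simp add: UNIV_bool)
  have "(\<Sum>bs\<in>lists_len (Suc n). bits_weight \<nu> bs * log_ratio \<mu> K bs)
     = (\<Sum>bs\<in>lists_len n. bits_weight \<nu> bs *
         ((pmf \<nu> True + pmf \<nu> False) * log_ratio \<mu> K bs + pmf \<nu> False * loss_cost \<mu> K bs))"
    by (simp add: sum_lists_len_Suc UNIV_bool log_ratio_True log_ratio_False bits_weight_def algebra_simps)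
  also have "\<dots> \<le> (\<Sum>bs\<in>lists_len n. bits_weight \<nu> bs *
         (log_ratio \<mu> K bs + pmf \<nu> False * loss_cost \<mu> K (replicate n False)))"
  proof (intro sum_mono mult_left_mono)
    fix bs :: "bool list" assume "bs \<in> lists_len n"
    then have "loss_cost \<mu> K bs \<le> loss_cost \<mu> K (replicate n False)"
      using loss_cost_le[of \<mu> K bs] by simp
    then show "(pmf \<nu> True + pmf \<nu> False) * log_ratio \<mu> K bs + pmf \<nu> False * loss_cost \<mu> K bs
       \<le> log_ratio \<mu> K bs + pmf \<nu> False * loss_cost \<mu> K (replicate n False)"
      unfolding one by (simp add: mult_left_mono)
  qed simp
  also have "\<dots> = (\<Sum>bs\<in>lists_len n. bits_weight \<nu> bs * log_ratio \<mu> K bs)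
      + pmf \<nu> False * loss_cost \<mu> K (replicate n False)"
    by (simp add: distrib_left sum.distrib sum_distrib_right[symmetric] sum_bits_weight)
  also have "\<dots> \<le> pmf \<nu> False * log_ratio \<mu> K (replicate (Suc n) False)"
    using Suc by (simp add: log_ratio_False distrib_left)
  finally show ?case .
qed

text \<open>Jensen's inequality for \<open>ln\<close>, by the tangent at the mean
  \<open>m\<close>.\<close>

lemma ln_sum_ge:
  fixes w f :: "'b \<Rightarrow> real"
  assumes "finite B" "\<And>b. b \<in> B \<Longrightarrow> 0 \<le> w b" "(\<Sum>b\<in>B. w b) = 1" "\<And>b. b \<in> B \<Longrightarrow> 0 < f b"
  shows "0 < (\<Sum>b\<in>B. w b * f b)" "(\<Sum>b\<in>B. w b * ln (f b)) \<le> ln (\<Sum>b\<in>B. w b * f b)"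
proof -
  define m where "m = (\<Sum>b\<in>B. w b * f b)"
  obtain b where b: "b \<in> B" "0 < w b"
    using assms(2,3) by (metis less_eq_real_def sum.not_neutral_contains_not_neutral zero_neq_one)
  have "0 < w b * f b" using b assms(4) by simp
  also have "\<dots> \<le> m" unfolding m_def using b assms by (intro member_le_sum) (auto simp: less_imp_le)
  finally have m: "0 < m" .
  then show "0 < (\<Sum>b\<in>B. w b * f b)" by (simp add: m_def)
  have "(\<Sum>b\<in>B. w b * ln (f b)) \<le> (\<Sum>b\<in>B. w b * (ln m + (f b / m - 1)))"
  proof (intro sum_mono mult_left_mono)
    fix b assume "b \<in> B"
    then have "0 < f b" using assms by auto
    then show "ln (f b) \<le> ln m + (f b / m - 1)"
      using ln_le_minus_one[of "f b / m"] m by (simp add: ln_div)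
  qed (use assms in auto)
  also have "\<dots> = (\<Sum>b\<in>B. w b) * (ln m - 1) + (\<Sum>b\<in>B. w b * f b) / m"
    by (simp add: algebra_simps sum.distrib sum_subtractf sum_distrib_left sum_divide_distrib)
  also have "\<dots> = ln m" using assms(3) m by (simp add: m_def[symmetric])
  finally show "(\<Sum>b\<in>B. w b * ln (f b)) \<le> ln (\<Sum>b\<in>B. w b * f b)" by (simp add: m_def)
qed

definition mix_lik :: "bool pmf \<Rightarrow> ('n, 'st::finite, 'ac::finite) jstep pmf \<Rightarrow> (('n::finite, 'st, 'ac) jstep \<Rightarrow> ('n, 'st, 'ac) jstep pmf)
    \<Rightarrow> ('n, 'st, 'ac) jstep list \<Rightarrow> real" where
  "mix_lik \<nu> \<mu> K h = (\<Sum>bs\<in>lists_len (length h). bits_weight \<nu> bs * lik \<mu> K bs h)"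

lemma mix_lik_pos: "0 < path_weight \<mu> K h \<Longrightarrow> 0 < mix_lik \<nu> \<mu> K h"
  unfolding mix_lik_def by (intro ln_sum_ge(1)) (auto simp: sum_bits_weight intro: lik_pos)

lemma mix_lik_return_False:
  "mix_lik (return_pmf False) \<mu> K h = lik \<mu> K (replicate (length h) False) h"
proof -
  have "bits_weight (return_pmf False) bs = indicator {replicate (length bs) False} bs" for bs
    by (induction bs) (auto simp: bits_weight_def indicator_def)
  then have "mix_lik (return_pmf False) \<mu> K h
     = (\<Sum>bs\<in>lists_len (length h). indicator {replicate (length h) False} bs * lik \<mu> K bs h)"
    unfolding mix_lik_def by (intro sum.cong) auto
  then show ?thesis by (simp add: sum_mult_indicator sum.delta indicator_def if_distrib cong: if_cong)
qed

lemma lik_replicate_True: "length h = n \<Longrightarrow> lik \<mu> K (replicate n True) h = path_weight \<mu> K h"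
proof (induction n arbitrary: h)
  case (Suc n)
  then show ?case by (cases h) auto
qed simp

text \<open>Keeps only the summand in which communication is always available; this is the source of
  the powers of \<open>1 - q\<close> in the second bound.\<close>

lemma mix_lik_ge:
  assumes "0 < path_weight \<mu> K h"
  shows "pmf \<nu> True ^ length h * path_weight \<mu> K h \<le> mix_lik \<nu> \<mu> K h"
proof -
  let ?t = "replicate (length h) True"
  have "pmf \<nu> True ^ length h * path_weight \<mu> K h = bits_weight \<nu> ?t * lik \<mu> K ?t h"
    by (simp add: lik_replicate_True bits_weight_def)
  also have "\<dots> \<le> mix_lik \<nu> \<mu> K h"
    unfolding mix_lik_def using assms by (intro member_le_sum) (auto simp: less_imp_le lik_pos)
  finally show ?thesis .
qed

text \<open>Convexity of the divergence in its second argument takes the average over the bits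
  outside, where \<open>mean_log_ratio_le\<close> applies. The law \<open>return_pmf False\<close>
  of the bits is imaginary play.\<close>

lemma prefix_divergence_le:
  "(\<Sum>h\<in>lists_len n. path_weight \<mu> K h * ln (path_weight \<mu> K h / mix_lik \<nu> \<mu> K h))
    \<le> pmf \<nu> False * (\<Sum>h\<in>lists_len n. path_weight \<mu> K h * ln (path_weight \<mu> K h / mix_lik (return_pmf False) \<mu> K h))"
proof -
  have "(\<Sum>h\<in>lists_len n. path_weight \<mu> K h * ln (path_weight \<mu> K h / mix_lik \<nu> \<mu> K h))
    \<le> (\<Sum>h\<in>lists_len n. \<Sum>bs\<in>lists_len n. bits_weight \<nu> bs * (path_weight \<mu> K h * ln (path_weight \<mu> K h / lik \<mu> K bs h)))"
  proof (intro sum_mono)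
    fix h :: "('a, 'b, 'c) jstep list" assume h: "h \<in> lists_len n"
    let ?p = "path_weight \<mu> K h"
    show "?p * ln (?p / mix_lik \<nu> \<mu> K h) \<le> (\<Sum>bs\<in>lists_len n. bits_weight \<nu> bs * (?p * ln (?p / lik \<mu> K bs h)))"
    proof (cases "?p = 0")
      case False
      then have p: "0 < ?p" using path_weight_nonneg[of \<mu> K h] by linarith
      have lp: "0 < lik \<mu> K bs h" if "bs \<in> lists_len n" for bs using lik_pos[OF p] that h by simp
      have "(\<Sum>bs\<in>lists_len n. bits_weight \<nu> bs * ln (lik \<mu> K bs h)) \<le> ln (mix_lik \<nu> \<mu> K h)"
        using ln_sum_ge(2)[of "lists_len n" "bits_weight \<nu>" "\<lambda>bs. lik \<mu> K bs h"] lp h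
        by (simp add: mix_lik_def sum_bits_weight)
      then have "?p * ln (?p / mix_lik \<nu> \<mu> K h)
          \<le> ?p * (ln ?p - (\<Sum>bs\<in>lists_len n. bits_weight \<nu> bs * ln (lik \<mu> K bs h)))"
        using p mix_lik_pos[OF p, of \<nu>] by (intro mult_left_mono) (auto simp: ln_div)
      also have "\<dots> = ?p * (\<Sum>bs\<in>lists_len n. bits_weight \<nu> bs * (ln ?p - ln (lik \<mu> K bs h)))"
        by (simp add: right_diff_distrib sum_subtractf sum_distrib_right[symmetric] sum_bits_weight)
      also have "\<dots> = (\<Sum>bs\<in>lists_len n. bits_weight \<nu> bs * (?p * ln (?p / lik \<mu> K bs h)))"
        unfolding sum_distrib_left
      proof (intro sum.cong refl)
        fix bs :: "bool list" assume "bs \<in> lists_len n"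
        from lp[OF this] p show "?p * (bits_weight \<nu> bs * (ln ?p - ln (lik \<mu> K bs h)))
            = bits_weight \<nu> bs * (?p * ln (?p / lik \<mu> K bs h))"
          by (simp add: ln_div)
      qed
      finally show ?thesis .
    qed simp
  qed
  also have "\<dots> = (\<Sum>bs\<in>lists_len n. bits_weight \<nu> bs * log_ratio \<mu> K bs)"
    by (subst sum.swap) (auto simp: log_ratio_def sum_distrib_left intro!: sum.cong)
  also have "\<dots> \<le> pmf \<nu> False * log_ratio \<mu> K (replicate n False)" by (rule mean_log_ratio_le)
  also have "log_ratio \<mu> K (replicate n False)
    = (\<Sum>h\<in>lists_len n. path_weight \<mu> K h * ln (path_weight \<mu> K h / mix_lik (return_pmf False) \<mu> K h))"
    by (simp add: log_ratio_def mix_lik_return_False)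
  finally show ?thesis .
qed

section \<open>Path measures\<close>

text \<open>The property by which \<open>path_measure\<close> selects its measure. Nothing follows
  about the path laws until existence and uniqueness are shown.\<close>

definition is_path_measure :: "(nat \<Rightarrow> 'y list pmf) \<Rightarrow> 'y stream measure \<Rightarrow> bool" where
  "is_path_measure P M \<longleftrightarrow> sets M = sets (stream_space (count_space UNIV)) \<and>
     (\<forall>n xs. emeasure M {\<omega> \<in> space M. stake n \<omega> = xs} = ennreal (pmf (P n) xs))"

lemma is_path_measure_space:
  assumes "is_path_measure P M"
  shows "sets M = sets (stream_space (count_space UNIV))" "space M = UNIV"
proof -
  show s: "sets M = sets (stream_space (count_space UNIV))" using assms by (simp add: is_path_measure_def)
  show "space M = UNIV" using sets_eq_imp_space_eq[OF s] by (simp add: space_stream_space)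
qed

lemma is_path_measure_cylinder:
  "is_path_measure P M \<Longrightarrow> emeasure M {\<omega>. stake n \<omega> = xs} = ennreal (pmf (P n) xs)"
  using is_path_measure_space(2)[of P M] by (auto simp: is_path_measure_def)

lemma is_path_measure_prob_space:
  assumes "is_path_measure P M" "P 0 = return_pmf []"
  shows "prob_space M"
proof
  have "space M = {\<omega>. stake 0 \<omega> = []}" using is_path_measure_space(2)[OF assms(1)] by simp
  then show "emeasure M (space M) = 1"
    using is_path_measure_cylinder[OF assms(1), of 0 "[]"] assms(2) by simp
qed

lemma sstart_UNIV: "sstart UNIV xs = {\<omega>. stake (length xs) \<omega> = xs}"
proof (induction xs)
  case (Cons x xs)
  have "s \<in> sstart UNIV (x # xs) \<longleftrightarrow> s \<in> {\<omega>. stake (length (x # xs)) \<omega> = x # xs}" for s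
    using Cons by auto
  then show ?case by blast
qed (simp add: sstart.simps)

lemma sets_cylinder:
  "{\<omega>. stake n \<omega> = xs} \<in> sets (stream_space (count_space UNIV))" for xs :: "'y::countable list"
proof -
  have "{\<omega> \<in> space (stream_space (count_space UNIV)). stake n \<omega> = xs} \<in> sets (stream_space (count_space UNIV))"
    by measurable
  then show ?thesis by (simp add: space_stream_space)
qed

lemma path_measure_eqI:
  fixes P :: "nat \<Rightarrow> 'y::countable list pmf"
  assumes M: "is_path_measure P M" and P0: "P 0 = return_pmf []"
  shows "path_measure P = M"
proof -
  have "N = M" if N: "is_path_measure P N" for N
  proof (rule stream_space_eq_sstart[of UNIV])
    show "prob_space N" "prob_space M" using is_path_measure_prob_space M N P0 by auto
    show "emeasure N (sstart UNIV xs) = emeasure M (sstart UNIV xs)" for xs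
      unfolding sstart_UNIV is_path_measure_cylinder[OF M] is_path_measure_cylinder[OF N] ..
  qed (use is_path_measure_space[OF M] is_path_measure_space[OF N] in auto)
  then show ?thesis unfolding path_measure_def is_path_measure_def[symmetric]
    using M by (rule the_equality[rotated])
qed

lemma distr_stake:
  fixes P :: "nat \<Rightarrow> 'y::countable list pmf"
  assumes M: "is_path_measure P M"
  shows "distr M (count_space UNIV) (stake n) = measure_pmf (P n)"
proof (rule measure_eqI_countable[where A = UNIV])
  note [measurable_cong] = is_path_measure_space(1)[OF M]
  have [measurable]: "stake n \<in> measurable M (count_space UNIV)" by measurable
  fix xs :: "'y list"
  have "emeasure (distr M (count_space UNIV) (stake n)) {xs} = emeasure M {\<omega>. stake n \<omega> = xs}"
    using is_path_measure_space(2)[OF M] by (subst emeasure_distr) (auto intro!: arg_cong[where f = "emeasure M"])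
  then show "emeasure (distr M (count_space UNIV) (stake n)) {xs} = emeasure (measure_pmf (P n)) {xs}"
    by (simp add: is_path_measure_cylinder[OF M] emeasure_pmf_single)
qed auto

lemma emeasure_prefix_event:
  fixes P :: "nat \<Rightarrow> 'y::countable list pmf"
  assumes M: "is_path_measure P M"
  shows "emeasure M {\<omega>. stake n \<omega> \<in> E} = emeasure (measure_pmf (P n)) E"
    and "{\<omega>. stake n \<omega> \<in> E} \<in> sets M"
proof -
  note [measurable_cong] = is_path_measure_space(1)[OF M]
  have [measurable]: "stake n \<in> measurable M (count_space UNIV)" by measurable
  have eq: "{\<omega>. stake n \<omega> \<in> E} = stake n -` E \<inter> space M" using is_path_measure_space(2)[OF M] by auto
  show "{\<omega>. stake n \<omega> \<in> E} \<in> sets M" unfolding eq by measurable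
  show "emeasure M {\<omega>. stake n \<omega> \<in> E} = emeasure (measure_pmf (P n)) E"
    unfolding eq distr_stake[OF M, of n, symmetric] by (subst emeasure_distr) auto
qed

text \<open>Prefixes of an image stream are images of prefixes. This gives existence for
  \<open>int_paths\<close>, which is specified by mapped prefix laws that need not be
  Markov.\<close>

lemma is_path_measure_smap:
  fixes P :: "nat \<Rightarrow> 'y::countable list pmf" and f :: "'y \<Rightarrow> 'z::countable"
  assumes M: "is_path_measure P M"
  shows "is_path_measure (\<lambda>n. map_pmf (map f) (P n)) (distr M (stream_space (count_space UNIV)) (smap f))"
  unfolding is_path_measure_def
proof (intro conjI allI)
  note [measurable_cong] = is_path_measure_space(1)[OF M]
  fix n xs
  let ?N = "distr M (stream_space (count_space UNIV)) (smap f)"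
  have [measurable]: "smap f \<in> measurable M (stream_space (count_space UNIV))" by measurable
  have "emeasure ?N {\<omega> \<in> space ?N. stake n \<omega> = xs} = emeasure M {\<omega>. stake n \<omega> \<in> map f -` {xs}}"
    using is_path_measure_space(2)[OF M]
    by (subst emeasure_distr) (auto simp: space_stream_space sets_cylinder intro!: arg_cong[where f = "emeasure M"])
  also have "\<dots> = ennreal (pmf (map_pmf (map f) (P n)) xs)"
    unfolding emeasure_prefix_event(1)[OF M] pmf_map by (simp add: measure_pmf.emeasure_eq_measure)
  finally show "emeasure ?N {\<omega> \<in> space ?N. stake n \<omega> = xs} = ennreal (pmf (map_pmf (map f) (P n)) xs)" .
qed simp

primcorec run :: "'x \<Rightarrow> ('x \<Rightarrow> 'x) stream \<Rightarrow> 'x stream" where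
  "run x \<omega> = x ## run (shd \<omega> x) (stl \<omega>)"

lemma run_snth: "run x \<omega> !! n = foldl (\<lambda>y f. f y) x (stake n \<omega>)"
  by (induction n arbitrary: x \<omega>) auto

lemma markov_prefix_bind: "markov_prefix \<mu> K n = bind_pmf \<mu> (\<lambda>x. markov_prefix (return_pmf x) K n)"
  by (cases n) (auto simp: bind_return_pmf)

text \<open>The chain is realized by iterating independent random self-maps of the state space, each of
  which moves every \<open>x\<close> according to \<open>K x\<close>.\<close>

lemma ex_markov_path_measure:
  fixes \<mu> :: "'x::finite pmf"
  shows "\<exists>M. is_path_measure (markov_prefix \<mu> K) M"
proof -
  define D where "D = Pi_pmf (UNIV :: 'x set) undefined K"
  define \<Omega> where "\<Omega> = stream_space (measure_pmf D)"
  let ?S = "stream_space (count_space (UNIV :: 'x set))"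
  interpret \<Omega>: prob_space \<Omega> unfolding \<Omega>_def by (rule prob_space.prob_space_stream_space[OF prob_space_measure_pmf])
  have sets\<Omega>: "sets \<Omega> = sets (stream_space (count_space UNIV))"
    unfolding \<Omega>_def by (rule sets_stream_space_cong) simp
  note [measurable_cong] = sets\<Omega>
  have space\<Omega>: "space \<Omega> = UNIV" by (simp add: \<Omega>_def space_stream_space)
  have run_meas [measurable]: "run x \<in> measurable \<Omega> ?S" for x
    \<comment> \<open>Each coordinate of \<open>run x\<close> depends on finitely many of the maps
      only, as \<open>run_snth\<close> shows.\<close>
    by (rule measurable_stream_space2) (unfold run_snth, measurable)
  have cyl [measurable]: "{\<omega>. stake n (run x \<omega>) = xs} \<in> sets \<Omega>" for n x xs
  proof -
    have "{\<omega>. stake n (run x \<omega>) = xs} = {\<omega> \<in> space \<Omega>. stake n (run x \<omega>) = xs}" by (simp add: space\<Omega>)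
    also have "\<dots> \<in> sets \<Omega>" by measurable
    finally show ?thesis .
  qed
  have run: "emeasure \<Omega> {\<omega>. stake n (run x \<omega>) = xs} = ennreal (pmf (markov_prefix (return_pmf x) K n) xs)" for n x xs
  proof (induction n arbitrary: x xs)
    case 0
    show ?case using \<Omega>.emeasure_space_1 space\<Omega> by (cases "xs = []") auto
  next
    case (Suc n)
    have K: "map_pmf (\<lambda>f. f x) D = K x" unfolding D_def by (rule Pi_pmf_component[THEN trans]) auto
    have "emeasure \<Omega> {\<omega>. stake (Suc n) (run x \<omega>) = xs}
        = (\<integral>\<^sup>+f. emeasure \<Omega> {\<omega>. x # stake n (run (f x) \<omega>) = xs} \<partial>D)"
      using prob_space.emeasure_stream_space[OF prob_space_measure_pmf, of "{\<omega>. stake (Suc n) (run x \<omega>) = xs}" D] cyl[of "Suc n" x xs] space\<Omega>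
      unfolding \<Omega>_def[symmetric] by simp
    also have "\<dots> = ennreal (pmf (markov_prefix (return_pmf x) K (Suc n)) xs)"
    proof (cases "\<exists>ys. xs = x # ys")
      case True
      then obtain ys where xs: "xs = x # ys" by blast
      have "(\<integral>\<^sup>+f. emeasure \<Omega> {\<omega>. x # stake n (run (f x) \<omega>) = xs} \<partial>D)
         = (\<integral>\<^sup>+f. ennreal (pmf (markov_prefix (return_pmf (f x)) K n) ys) \<partial>D)"
        by (simp add: xs Suc.IH)
      also have "\<dots> = (\<integral>\<^sup>+y. ennreal (pmf (markov_prefix (return_pmf y) K n) ys) \<partial>map_pmf (\<lambda>f. f x) D)"
        by simp
      also have "\<dots> = ennreal (pmf (markov_prefix (K x) K n) ys)"
        unfolding K by (subst markov_prefix_bind) (simp add: ennreal_pmf_bind)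
      also have "pmf (markov_prefix (K x) K n) ys = pmf (markov_prefix (return_pmf x) K (Suc n)) xs"
      proof -
        have "pmf (map_pmf ((#) x) (markov_prefix (K x) K n)) (x # ys) = pmf (markov_prefix (K x) K n) ys"
          by (rule pmf_map_inj') auto
        then show ?thesis by (simp add: xs bind_return_pmf map_pmf_def)
      qed
      finally show ?thesis .
    next
      case False
      then have "{\<omega>. x # stake n (run (f x) \<omega>) = xs} = {}" for f by auto
      moreover have "pmf (markov_prefix (return_pmf x) K (Suc n)) xs = 0"
        using False by (auto simp: bind_return_pmf pmf_eq_0_set_pmf)
      ultimately show ?thesis by (simp del: markov_prefix.simps)
    qed
    finally show ?case .
  qed
  define N where "N = measure_pmf \<mu> \<bind> (\<lambda>x. distr \<Omega> ?S (run x))"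
  have meas: "(\<lambda>x. distr \<Omega> ?S (run x)) \<in> measurable (measure_pmf \<mu>) (subprob_algebra ?S)"
    by (auto simp: space_subprob_algebra intro!: prob_space_imp_subprob_space \<Omega>.prob_space_distr)
  have setsN: "sets N = sets ?S"
    unfolding N_def by (rule sets_bind[OF _ ]) auto
  have spaceN: "space N = UNIV" using sets_eq_imp_space_eq[OF setsN] by (simp add: space_stream_space)
  have "emeasure N {\<omega>. stake n \<omega> = xs} = ennreal (pmf (markov_prefix \<mu> K n) xs)" for n xs
  proof -
    have S: "{\<omega>. stake n \<omega> = xs} \<in> sets ?S" by (rule sets_cylinder)
    have "emeasure N {\<omega>. stake n \<omega> = xs} = (\<integral>\<^sup>+x. emeasure (distr \<Omega> ?S (run x)) {\<omega>. stake n \<omega> = xs} \<partial>\<mu>)"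
      unfolding N_def by (rule emeasure_bind[OF _ meas S]) simp
    also have "\<dots> = (\<integral>\<^sup>+x. ennreal (pmf (markov_prefix (return_pmf x) K n) xs) \<partial>\<mu>)"
      using S by (simp add: emeasure_distr space\<Omega> vimage_def run)
    also have "\<dots> = ennreal (pmf (markov_prefix \<mu> K n) xs)"
      by (subst (2) markov_prefix_bind) (simp add: ennreal_pmf_bind)
    finally show ?thesis .
  qed
  then show ?thesis using setsN spaceN unfolding is_path_measure_def by auto
qed

section \<open>The augmented chain\<close>

text \<open>The states that the augmented chain visits have this form: an agent always sees its own
  real component, so the family of joint steps that the agents have in mind carries
  everything.\<close>

definition aug_of :: "('n \<Rightarrow> ('n, 'st, 'ac) jstep) \<Rightarrow> ('n, 'st, 'ac) aug" where
  "aug_of y = (\<lambda>i. fst (y i) i, \<lambda>i. fst (y i), \<lambda>i. snd (y i))"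

lemma realize_aug_of: "realize (aug_of y) = diag y"
  by (simp add: aug_of_def realize_def diag_def)

lemma diag_const [simp]: "diag (\<lambda>_. x) = x"
  by (simp add: diag_def)

lemma inj_aug_of: "inj aug_of"
  by (auto simp: inj_def aug_of_def fun_eq_iff prod_eq_iff)

lemma pmf_bind_Pair: "pmf (bind_pmf M (\<lambda>x. map_pmf (Pair x) (N x))) (x, y) = pmf M x * pmf (N x) y"
proof -
  have "pmf (map_pmf (Pair u) (N u)) (x, y) = pmf (N x) y * indicator {x} u" for u
  proof (cases "u = x")
    case True
    have "inj (Pair x)" by (auto simp: inj_def)
    then show ?thesis using pmf_map_inj'[of "Pair x" "N x" y] True by simp
  qed (auto simp: pmf_eq_0_set_pmf)
  then show ?thesis by (simp add: pmf_bind measure_pmf_single)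
qed

lemma Pi_pmf_UNIV_default: "Pi_pmf (UNIV :: 'i::finite set) d p = Pi_pmf UNIV d' p"
  using Pi_pmf_default_swap[of UNIV d' d p] by simp

text \<open>The real move of agent \<open>i\<close> is drawn from \<open>T i\<close> at its own
  state and its own sampled action, just as component \<open>i\<close> of a full-communication step
  from \<open>y i\<close> would be. Hence in a lost step the agents run \<open>full_kernel\<close>
  independently, each from its own joint step.\<close>

lemma imaginary_step_eq:
  fixes T :: "'n::finite \<Rightarrow> 'st \<Rightarrow> 'ac \<Rightarrow> 'st pmf"
  defines "s y \<equiv> \<lambda>i. fst (y i) i" and "a y \<equiv> \<lambda>i. snd (y i) i"
  shows "bind_pmf (joint_T T (s y) (a y)) (\<lambda>s'. decide \<pi> False s' (imag_step T s' (\<lambda>i. fst (y i)) (\<lambda>i. snd (y i))))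
    = map_pmf aug_of (Pi_pmf UNIV undefined (\<lambda>i. full_kernel T \<pi> (y i)))"
    (is "?L = ?R")
proof (rule pmf_eqI)
  fix z :: "('n, 'st, 'ac) aug"
  obtain s1 sh ah where z: "z = (s1, sh, ah)" by (cases z) auto
  let ?t = "\<lambda>i j. pmf (T j (fst (y i) j) (snd (y i) j)) (sh i j)"
  let ?r = "\<lambda>i j. pmf (if j = i then return_pmf (s1 i) else T j (fst (y i) j) (snd (y i) j)) (sh i j)"
  have "?L = bind_pmf (joint_T T (s y) (a y)) (\<lambda>s'. map_pmf (Pair s')
      (bind_pmf (imag_step T s' (\<lambda>i. fst (y i)) (\<lambda>i. snd (y i)))
         (\<lambda>sh. map_pmf (Pair sh) (Pi_pmf UNIV undefined (\<lambda>i. \<pi> (sh i))))))"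
    by (simp add: decide_def map_bind_pmf pmf.map_comp comp_def)
  then have "pmf ?L z = pmf (joint_T T (s y) (a y)) s1 *
      (pmf (imag_step T s1 (\<lambda>i. fst (y i)) (\<lambda>i. snd (y i))) sh * pmf (Pi_pmf UNIV undefined (\<lambda>i. \<pi> (sh i))) ah)"
    by (simp only: z pmf_bind_Pair)
  also have "\<dots> = (\<Prod>i\<in>UNIV. pmf (T i (s y i) (a y i)) (s1 i) * (\<Prod>j\<in>UNIV. ?r i j) * pmf (\<pi> (sh i)) (ah i))"
    by (simp add: joint_T_def imag_step_def pmf_Pi prod.distrib)
  finally have L: "pmf ?L z = \<dots>" .
  show "pmf ?L z = pmf ?R z"
  proof (cases "s1 = (\<lambda>i. sh i i)")
    case True
    have ze: "z = aug_of (\<lambda>i. (sh i, ah i))" by (simp add: z aug_of_def True)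
    have "pmf ?R z = (\<Prod>i\<in>UNIV. pmf (full_kernel T \<pi> (y i)) (sh i, ah i))"
      unfolding ze pmf_map_inj'[OF inj_aug_of] by (simp add: pmf_Pi)
    also have "\<dots> = (\<Prod>i\<in>UNIV. (\<Prod>j\<in>UNIV. ?t i j) * pmf (\<pi> (sh i)) (ah i))"
      by (simp add: full_kernel_def pmf_bind_Pair joint_T_def pmf_Pi)
    also have "\<dots> = pmf ?L z"
      unfolding L
    proof (intro prod.cong refl arg_cong2[of _ _ _ _ "(*)"])
      fix i
      \<comment> \<open>At \<open>j = i\<close> the imagined move in \<open>?t\<close> has the
        probability of the real move, while the point mass in \<open>?r\<close> contributes
        1.\<close>
      have "(\<Prod>j\<in>UNIV. ?t i j) = ?t i i * (\<Prod>j\<in>UNIV - {i}. ?t i j)"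
        by (rule prod.remove) auto
      moreover have "(\<Prod>j\<in>UNIV. ?r i j) = ?r i i * (\<Prod>j\<in>UNIV - {i}. ?r i j)"
        by (rule prod.remove) auto
      moreover have "(\<Prod>j\<in>UNIV - {i}. ?r i j) = (\<Prod>j\<in>UNIV - {i}. ?t i j)"
        by (intro prod.cong) auto
      ultimately show "(\<Prod>j\<in>UNIV. ?t i j) = pmf (T i (s y i) (a y i)) (s1 i) * (\<Prod>j\<in>UNIV. ?r i j)"
        by (simp add: True s_def a_def)
    qed
    finally show ?thesis by simp
  next
    case False
    then obtain i where i: "s1 i \<noteq> sh i i" by auto
    then have r0: "(\<Prod>j\<in>UNIV. ?r i j) = 0" by (intro prod_zero) (auto intro!: exI[of _ i] simp: indicator_def)
    have "pmf ?L z = 0" unfolding L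
      by (intro prod_zero bexI[of _ i]) (simp_all only: r0 mult_zero_left mult_zero_right finite UNIV_I)
    moreover have "pmf ?R z = 0"
      using False by (auto simp: pmf_eq_0_set_pmf z aug_of_def)
    ultimately show ?thesis by simp
  qed
qed

lemma int_kernel_aug_of:
  fixes T :: "'n::finite \<Rightarrow> 'st \<Rightarrow> 'ac \<Rightarrow> 'st pmf"
  shows "int_kernel T \<pi> \<nu> (aug_of y) = bind_pmf \<nu> (\<lambda>b.
    if b then map_pmf (\<lambda>x. aug_of (\<lambda>_. x)) (full_kernel T \<pi> (diag y))
    else map_pmf aug_of (Pi_pmf UNIV undefined (\<lambda>i. full_kernel T \<pi> (y i))))"
proof -
  have "int_kernel T \<pi> \<nu> (aug_of y) = bind_pmf \<nu> (\<lambda>b. bind_pmf (joint_T T (\<lambda>i. fst (y i) i) (\<lambda>i. snd (y i) i))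
      (\<lambda>s'. decide \<pi> b s' (imag_step T s' (\<lambda>i. fst (y i)) (\<lambda>i. snd (y i)))))"
    \<comment> \<open>The bit is independent of the real move and may be drawn first.\<close>
    unfolding int_kernel_def aug_of_def prod.case by (rule bind_commute_pmf)
  also have "\<dots> = bind_pmf \<nu> (\<lambda>b.
    if b then map_pmf (\<lambda>x. aug_of (\<lambda>_. x)) (full_kernel T \<pi> (diag y))
    else map_pmf aug_of (Pi_pmf UNIV undefined (\<lambda>i. full_kernel T \<pi> (y i))))"
  proof (rule bind_pmf_cong[OF refl])
    fix b
    show "bind_pmf (joint_T T (\<lambda>i. fst (y i) i) (\<lambda>i. snd (y i) i))
      (\<lambda>s'. decide \<pi> b s' (imag_step T s' (\<lambda>i. fst (y i)) (\<lambda>i. snd (y i))))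
      = (if b then map_pmf (\<lambda>x. aug_of (\<lambda>_. x)) (full_kernel T \<pi> (diag y))
        else map_pmf aug_of (Pi_pmf UNIV undefined (\<lambda>i. full_kernel T \<pi> (y i))))"
    proof (cases b)
      case True
      then show ?thesis
        by (simp add: decide_def full_kernel_def diag_def map_bind_pmf pmf.map_comp comp_def aug_of_def)
    next
      case False
      then show ?thesis using imaginary_step_eq[of T y \<pi>] by simp
    qed
  qed
  finally show ?thesis .
qed

lemma int_init_aug_of:
  fixes sI :: "'n::finite \<Rightarrow> 'st"
  shows "int_init \<pi> sI \<nu> = bind_pmf \<nu> (\<lambda>b.
    if b then map_pmf (\<lambda>x. aug_of (\<lambda>_. x)) (full_init \<pi> sI)
    else map_pmf aug_of (Pi_pmf UNIV undefined (\<lambda>i. full_init \<pi> sI)))"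
proof -
  have "Pi_pmf (UNIV :: 'n set) undefined (\<lambda>i. full_init \<pi> sI)
      = map_pmf (\<lambda>ah. (\<lambda>a. (sI, a)) \<circ> ah) (Pi_pmf UNIV undefined (\<lambda>i. \<pi> sI))"
    unfolding full_init_def by (subst Pi_pmf_UNIV_default, rule Pi_pmf_map) auto
  then show ?thesis
    unfolding int_init_def
    by (intro bind_pmf_cong refl)
       (simp add: decide_def full_init_def pmf.map_comp comp_def aug_of_def bind_return_pmf)
qed

text \<open>The realized history together with the current augmented state is enough to drive both
  chains, so equality of its law passes from step to step. \<open>None\<close> stands for the time
  before the first step, when the initial law replaces the kernel.\<close>

lemma aug_path_eq_hist:
  fixes T :: "'n::finite \<Rightarrow> 'st::finite \<Rightarrow> 'ac::finite \<Rightarrow> 'st pmf"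
  shows "map_pmf (\<lambda>l. (map realize l, if l = [] then None else Some (hd l)))
      (rev_path (int_init \<pi> sI \<nu>) (int_kernel T \<pi> \<nu>) n)
    = map_pmf (\<lambda>(bs, h, Y). (h, if h = [] then None else Some (aug_of (\<lambda>i. hd (Y i)))))
      (hist \<nu> (full_init \<pi> sI) (full_kernel T \<pi>) n)"
proof (induction n)
  case (Suc n)
  let ?\<mu> = "full_init \<pi> sI" and ?K = "full_kernel T \<pi>"
  let ?A = "rev_path (int_init \<pi> sI \<nu>) (int_kernel T \<pi> \<nu>)" and ?H = "hist \<nu> ?\<mu> ?K"
  let ?\<phi> = "\<lambda>l :: ('n, 'st, 'ac) aug list. (map realize l, if l = [] then None else Some (hd l))"
  let ?\<psi> = "\<lambda>(bs :: bool list, h :: ('n, 'st, 'ac) jstep list, Y :: 'n \<Rightarrow> ('n, 'st, 'ac) jstep list).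
      (h, if h = [] then None else Some (aug_of (\<lambda>i. hd (Y i))))"
  \<comment> \<open>The transition that both chains induce on this pair.\<close>
  define k where "k = (\<lambda>(h :: ('n, 'st, 'ac) jstep list, u). map_pmf (\<lambda>a. (realize a # h, Some a))
    (case u of None \<Rightarrow> int_init \<pi> sI \<nu> | Some a \<Rightarrow> int_kernel T \<pi> \<nu> a))"
  have "map_pmf ?\<phi> (?A (Suc n)) = bind_pmf (?A n) (\<lambda>l. k (?\<phi> l))"
    by (auto simp: map_bind_pmf pmf.map_comp comp_def k_def next_step_def neq_Nil_conv
        intro!: bind_pmf_cong split: list.splits)
  also have "\<dots> = bind_pmf (map_pmf ?\<phi> (?A n)) k" by (simp add: bind_map_pmf)
  also have "\<dots> = bind_pmf (?H n) (\<lambda>w. k (?\<psi> w))" unfolding Suc.IH by (simp add: bind_map_pmf)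
  also have "\<dots> = bind_pmf (?H n) (\<lambda>w. bind_pmf \<nu> (\<lambda>b. map_pmf ?\<psi> (hist_step ?\<mu> ?K w b)))"
  proof (rule bind_pmf_cong[OF refl])
    fix w assume w: "w \<in> set_pmf (?H n)"
    obtain bs h Y where wd: "w = (bs, h, Y)" by (cases w) auto
    note inv = set_pmf_hist[OF w[unfolded wd]]
    have "k (?\<psi> w) = map_pmf (\<lambda>a. (realize a # h, Some a)) (bind_pmf \<nu> (\<lambda>b.
      if b then map_pmf (\<lambda>x. aug_of (\<lambda>_. x)) (next_step ?\<mu> ?K h)
      else map_pmf aug_of (Pi_pmf UNIV undefined (\<lambda>i. next_step ?\<mu> ?K (Y i)))))"
    proof (cases "n = 0")
      case True
      then have h: "h = []" and Y: "Y i = []" for i using inv(2) inv(3)[of i] by auto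
      have ns: "next_step ?\<mu> ?K h = ?\<mu>" "\<And>i. next_step ?\<mu> ?K (Y i) = ?\<mu>"
        by (simp_all add: h Y next_step_def)
      show ?thesis unfolding ns by (simp add: wd k_def h int_init_aug_of)
    next
      case False
      then obtain x t where h: "h = x # t" using inv(2) by (cases h) auto
      have ns: "next_step ?\<mu> ?K (Y i) = ?K (hd (Y i))" for i
        using inv(3)[of i] False by (cases "Y i") (auto simp: next_step_def)
      have nh: "next_step ?\<mu> ?K h = ?K (diag (\<lambda>i. hd (Y i)))"
        using inv(4) False h by (auto simp: next_step_def)
      show ?thesis unfolding ns nh using h by (simp add: wd k_def int_kernel_aug_of)
    qed
    also have "\<dots> = bind_pmf \<nu> (\<lambda>b. map_pmf ?\<psi> (hist_step ?\<mu> ?K w b))"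
      unfolding map_bind_pmf
      by (intro bind_pmf_cong refl)
         (simp add: wd hist_step_def pmf.map_comp comp_def realize_aug_of)
    finally show "k (?\<psi> w) = bind_pmf \<nu> (\<lambda>b. map_pmf ?\<psi> (hist_step ?\<mu> ?K w b))" .
  qed
  also have "\<dots> = map_pmf ?\<psi> (?H (Suc n))" by (simp add: map_bind_pmf)
  finally show ?case .
qed simp

lemma pmf_int_prefix:
  fixes T :: "'n::finite \<Rightarrow> 'st::finite \<Rightarrow> 'ac::finite \<Rightarrow> 'st pmf"
  assumes pos: "0 < path_weight (full_init \<pi> sI) (full_kernel T \<pi>) (rev xs)"
  shows "pmf (map_pmf (map realize) (markov_prefix (int_init \<pi> sI \<nu>) (int_kernel T \<pi> \<nu>) (length xs))) xs
    = mix_lik \<nu> (full_init \<pi> sI) (full_kernel T \<pi>) (rev xs)"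
proof -
  let ?A = "rev_path (int_init \<pi> sI \<nu>) (int_kernel T \<pi> \<nu>) (length xs)"
  let ?H = "hist \<nu> (full_init \<pi> sI) (full_kernel T \<pi>) (length xs)"
  have "map_pmf fst (map_pmf (\<lambda>l. (map realize l, if l = [] then None else Some (hd l))) ?A)
     = map_pmf fst (map_pmf (\<lambda>(bs, h, Y). (h, if h = [] then None else Some (aug_of (\<lambda>i. hd (Y i))))) ?H)"
    unfolding aug_path_eq_hist ..
  then have "map_pmf (map realize) ?A = map_pmf (\<lambda>(bs, h, Y). h) ?H"
    by (simp add: pmf.map_comp comp_def split_beta')
  moreover have "map_pmf (map realize) (markov_prefix (int_init \<pi> sI \<nu>) (int_kernel T \<pi> \<nu>) (length xs))
     = map_pmf rev (map_pmf (map realize) ?A)"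
    by (simp add: markov_prefix_eq_rev_path pmf.map_comp comp_def rev_map)
  ultimately have "pmf (map_pmf (map realize) (markov_prefix (int_init \<pi> sI \<nu>) (int_kernel T \<pi> \<nu>) (length xs))) xs
     = pmf (map_pmf rev (map_pmf (\<lambda>(bs, h, Y). h) ?H)) (rev (rev xs))" by simp
  also have "\<dots> = pmf (map_pmf (\<lambda>(bs, h, Y). h) ?H) (rev xs)" by (rule pmf_map_inj') auto
  also have "\<dots> = mix_lik \<nu> (full_init \<pi> sI) (full_kernel T \<pi>) (rev xs)"
    using pos by (simp add: pmf_realized_history mix_lik_def)
  finally show ?thesis .
qed

lemma is_path_measure_full_paths:
  fixes T :: "'n::finite \<Rightarrow> 'st::finite \<Rightarrow> 'ac::finite \<Rightarrow> 'st pmf"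
  shows "is_path_measure (markov_prefix (full_init \<pi> s) (full_kernel T \<pi>)) (full_paths T \<pi> s)"
proof -
  obtain M where "is_path_measure (markov_prefix (full_init \<pi> s) (full_kernel T \<pi>)) M"
    using ex_markov_path_measure by blast
  then show ?thesis unfolding full_paths_def by (simp add: path_measure_eqI)
qed

lemma is_path_measure_int_paths:
  fixes T :: "'n::finite \<Rightarrow> 'st::finite \<Rightarrow> 'ac::finite \<Rightarrow> 'st pmf"
  shows "is_path_measure (\<lambda>n. map_pmf (map realize) (markov_prefix (int_init \<pi> s \<nu>) (int_kernel T \<pi> \<nu>) n))
    (int_paths T \<pi> s \<nu>)"
proof -
  obtain M where "is_path_measure (markov_prefix (int_init \<pi> s \<nu>) (int_kernel T \<pi> \<nu>)) M"
    using ex_markov_path_measure by blast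
  from is_path_measure_smap[OF this, of realize] show ?thesis
    unfolding int_paths_def by (simp add: path_measure_eqI)
qed

section \<open>Divergence inequalities\<close>

text \<open>Both sides are compared through the Bhattacharyya coefficient of \<open>p\<close> and \<open>r\<close>.\<close>

lemma bretagnolle_huber:
  fixes p r :: "'w \<Rightarrow> real"
  assumes fin: "finite \<Omega>" and p: "\<And>w. w \<in> \<Omega> \<Longrightarrow> 0 \<le> p w" and r: "\<And>w. w \<in> \<Omega> \<Longrightarrow> 0 \<le> r w"
    and ac: "\<And>w. w \<in> \<Omega> \<Longrightarrow> 0 < p w \<Longrightarrow> 0 < r w"
    and p1: "(\<Sum>w\<in>\<Omega>. p w) = 1" and r1: "(\<Sum>w\<in>\<Omega>. r w) = 1" and E: "E \<subseteq> \<Omega>"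
  shows "(\<Sum>w\<in>E. p w) - (\<Sum>w\<in>E. r w) \<le> sqrt (1 - exp (- (\<Sum>w\<in>\<Omega>. p w * ln (p w / r w))))"
proof -
  define x where "x = (\<Sum>w\<in>\<Omega>. p w * ln (p w / r w))"
  define a b where "a = (\<Sum>w\<in>E. p w)" and "b = (\<Sum>w\<in>E. r w)"
  have finE: "finite E" using fin E finite_subset by blast
  have a': "(\<Sum>w\<in>\<Omega> - E. p w) = 1 - a" and b': "(\<Sum>w\<in>\<Omega> - E. r w) = 1 - b"
    unfolding a_def b_def using sum_diff[OF fin E, of p] sum_diff[OF fin E, of r] p1 r1 by auto
  have ab: "0 \<le> a" "0 \<le> b" "0 \<le> 1 - a" "0 \<le> 1 - b"
    unfolding a'[symmetric] b'[symmetric] unfolding a_def b_def using p r E by (auto intro!: sum_nonneg)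
  have CS: "(\<Sum>w\<in>F. sqrt (p w * r w)) \<le> sqrt ((\<Sum>w\<in>F. p w) * (\<Sum>w\<in>F. r w))" if F: "F \<subseteq> \<Omega>" for F
  proof (rule real_le_rsqrt)
    have "(\<Sum>w\<in>F. sqrt (p w) * sqrt (r w))\<^sup>2 \<le> (\<Sum>w\<in>F. (sqrt (p w))\<^sup>2) * (\<Sum>w\<in>F. (sqrt (r w))\<^sup>2)"
      by (rule Cauchy_Schwarz_ineq_sum)
    also have "(\<Sum>w\<in>F. (sqrt (p w))\<^sup>2) = (\<Sum>w\<in>F. p w)" using p F by (intro sum.cong) auto
    also have "(\<Sum>w\<in>F. (sqrt (r w))\<^sup>2) = (\<Sum>w\<in>F. r w)" using r F by (intro sum.cong) auto
    finally show "(\<Sum>w\<in>F. sqrt (p w * r w))\<^sup>2 \<le> (\<Sum>w\<in>F. p w) * (\<Sum>w\<in>F. r w)"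
      by (simp add: real_sqrt_mult)
  qed
  \<comment> \<open>The correction \<open>x / 2 - ln (p w / r w) / 2\<close> has mean 0 under
    \<open>p\<close>, so it can be inserted; bounding \<open>1 + y\<close> by \<open>exp y\<close>
    then turns the sum into the Bhattacharyya coefficient.\<close>
  have "exp (- x / 2) = (\<Sum>w\<in>\<Omega>. exp (- x / 2) * (p w * (1 + (x / 2 - ln (p w / r w) / 2))))"
  proof -
    have "(\<Sum>w\<in>\<Omega>. p w * (1 + (x / 2 - ln (p w / r w) / 2)))
       = (\<Sum>w\<in>\<Omega>. p w) * (1 + x / 2) - (\<Sum>w\<in>\<Omega>. p w * ln (p w / r w)) / 2"
      by (simp add: algebra_simps sum.distrib sum_subtractf sum_distrib_left sum_divide_distrib)
    also have "\<dots> = 1" by (simp add: p1 x_def)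
    finally show ?thesis by (simp add: sum_distrib_left[symmetric])
  qed
  also have "\<dots> \<le> (\<Sum>w\<in>\<Omega>. sqrt (p w * r w))"
  proof (intro sum_mono)
    fix w assume w: "w \<in> \<Omega>"
    show "exp (- x / 2) * (p w * (1 + (x / 2 - ln (p w / r w) / 2))) \<le> sqrt (p w * r w)"
    proof (cases "p w = 0")
      case False
      then have pw: "0 < p w" using p[OF w] by simp
      then have rw: "0 < r w" using ac w by simp
      have "exp (- x / 2) * (p w * (1 + (x / 2 - ln (p w / r w) / 2)))
         \<le> exp (- x / 2) * (p w * exp (x / 2 - ln (p w / r w) / 2))"
        using pw by (intro mult_left_mono exp_ge_add_one_self) auto
      also have "\<dots> = p w * (exp (- x / 2) * exp (x / 2 - ln (p w / r w) / 2))" by (rule mult.left_commute)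
      also have "exp (- x / 2) * exp (x / 2 - ln (p w / r w) / 2) = exp (- ln (p w / r w) / 2)"
        by (subst mult_exp_exp) simp
      also have "p w * exp (- ln (p w / r w) / 2) = sqrt ((p w * exp (- ln (p w / r w) / 2))\<^sup>2)"
        using pw by simp
      also have "(p w * exp (- ln (p w / r w) / 2))\<^sup>2 = (p w)\<^sup>2 * exp (- ln (p w / r w))"
        by (simp add: power_mult_distrib exp_double[symmetric])
      also have "\<dots> = p w * r w"
        using pw rw by (simp add: exp_minus power2_eq_square)
      finally show ?thesis .
    qed simp
  qed
  also have "\<dots> = (\<Sum>w\<in>\<Omega> - E. sqrt (p w * r w)) + (\<Sum>w\<in>E. sqrt (p w * r w))"
    by (rule sum.subset_diff[OF E fin])
  also have "\<dots> \<le> sqrt ((1 - a) * (1 - b)) + sqrt (a * b)"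
    using CS[of "\<Omega> - E"] CS[OF E] by (simp add: a' b' a_def[symmetric] b_def[symmetric])
  finally have "(exp (- x / 2))\<^sup>2 \<le> (sqrt ((1 - a) * (1 - b)) + sqrt (a * b))\<^sup>2"
    by (intro power_mono) auto
  then have "exp (- x) \<le> (1 - a) * (1 - b) + a * b + 2 * sqrt ((1 - a) * (1 - b)) * sqrt (a * b)"
    using ab by (simp add: power2_sum exp_double[symmetric])
  \<comment> \<open>The cross term is regrouped so that the next bound completes the right-hand side
    to \<open>1 - (a - b)\<^sup>2\<close>.\<close>
  also have "2 * sqrt ((1 - a) * (1 - b)) * sqrt (a * b) = 2 * sqrt (a * (1 - a)) * sqrt (b * (1 - b))"
    using ab by (simp add: real_sqrt_mult)
  also have "\<dots> \<le> a * (1 - a) + b * (1 - b)"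
    using sum_squares_bound[of "sqrt (a * (1 - a))" "sqrt (b * (1 - b))"] ab by simp
  finally have "(a - b)\<^sup>2 \<le> 1 - exp (- x)" by (simp add: algebra_simps power2_eq_square)
  then show ?thesis unfolding a_def[symmetric] b_def[symmetric] x_def[symmetric]
    by (rule real_le_rsqrt)
qed

text \<open>Data processing for \<open>stake n\<close>, by Gibbs' inequality on path space: with
  \<open>f\<close> the density of \<open>M\<close> against \<open>N\<close> and \<open>g\<close> the
  ratio of prefix probabilities, \<open>g / f\<close> has \<open>M\<close>-mean at most 1, and
  \<open>ln (g / f) \<le> g / f - 1\<close> is integrated.\<close>

lemma prefix_divergence_le_KL_divergence:
  fixes P R :: "nat \<Rightarrow> 'y::countable list pmf"
  assumes M: "is_path_measure P M" "P 0 = return_pmf []" and N: "is_path_measure R N" "R 0 = return_pmf []"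
    and fin: "finite (set_pmf (P n))"
    and ac: "absolutely_continuous N M" and int: "integrable M (entropy_density (exp 1) N M)"
  shows "(\<Sum>xs\<in>set_pmf (P n). pmf (P n) xs * ln (pmf (P n) xs / pmf (R n) xs)) \<le> KL_divergence (exp 1) N M"
proof -
  interpret M: prob_space M using is_path_measure_prob_space[OF M] .
  interpret N: prob_space N using is_path_measure_prob_space[OF N] .
  note sM = is_path_measure_space[OF M(1)] and sN = is_path_measure_space[OF N(1)]
  note [measurable_cong] = sM(1) sN(1)
  have sets: "sets M = sets N" using sM sN by simp
  have [measurable]: "stake n \<in> measurable M (count_space UNIV)" "stake n \<in> measurable N (count_space UNIV)"
    by measurable
  define g where "g xs = pmf (P n) xs / pmf (R n) xs" for xs
  define f where "f \<omega> = RN_deriv N M \<omega>" for \<omega>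
  have [measurable]: "f \<in> borel_measurable N" unfolding f_def by measurable
  have M_eq: "density N f = M" unfolding f_def using N.density_RN_deriv[OF ac sets] by (simp add: fun_eq_iff)
  have R0: "pmf (P n) xs = 0" if "pmf (R n) xs = 0" for xs
  proof -
    have "emeasure N {\<omega>. stake n \<omega> = xs} = 0" using is_path_measure_cylinder[OF N(1)] that by simp
    moreover have "{\<omega>. stake n \<omega> = xs} \<in> sets N" using sN(1) sets_cylinder by blast
    ultimately have "{\<omega>. stake n \<omega> = xs} \<in> null_sets M"
      using ac unfolding absolutely_continuous_def by (auto simp: null_sets_def)
    then have "emeasure M {\<omega>. stake n \<omega> = xs} = 0" by auto
    then show ?thesis using is_path_measure_cylinder[OF M(1)] by simp
  qed
  have AEg: "AE \<omega> in M. 0 < g (stake n \<omega>)"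
  proof -
    have "AE xs in measure_pmf (P n). 0 < g xs"
      unfolding AE_measure_pmf_iff g_def using R0 by (auto simp: set_pmf_iff pmf_nonneg order_less_le)
    then have "AE xs in distr M (count_space UNIV) (stake n). 0 < g xs" unfolding distr_stake[OF M(1)] .
    then show ?thesis by (simp add: AE_distr_iff)
  qed
  have AEf: "AE \<omega> in M. 0 < f \<omega> \<and> f \<omega> < \<infinity>"
  proof -
    have "AE \<omega> in N. f \<omega> \<noteq> \<infinity>"
      unfolding f_def using N.RN_deriv_finite[OF M.sigma_finite_measure_axioms ac sets] .
    then have "AE \<omega> in density N f. 0 < f \<omega> \<and> f \<omega> < \<infinity>"
      by (subst AE_density) (auto simp: less_top)
    then show ?thesis unfolding M_eq .
  qed
  \<comment> \<open>First \<open>g / f\<close> in \<open>ennreal\<close>, where the change of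
    measure needs no integrability; \<open>e\<close> below is its real version.\<close>
  define d where "d \<omega> = ennreal (g (stake n \<omega>)) / f \<omega>" for \<omega>
  have [measurable]: "(\<lambda>\<omega>. ennreal (g (stake n \<omega>))) \<in> borel_measurable N" by measurable
  have d_meas: "d \<in> borel_measurable N" unfolding d_def by measurable
  have d_meas': "d \<in> borel_measurable M" using d_meas sets by (simp cong: measurable_cong_sets)
  have d_le: "(\<integral>\<^sup>+\<omega>. d \<omega> \<partial>M) \<le> 1"
  proof -
    have "(\<integral>\<^sup>+\<omega>. d \<omega> \<partial>M) = (\<integral>\<^sup>+\<omega>. f \<omega> * d \<omega> \<partial>N)"
      using d_meas by (subst M_eq[symmetric], subst nn_integral_density) auto
    \<comment> \<open>Only an inequality: where \<open>f\<close> vanishes the left side is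
      0.\<close>
    also have "\<dots> \<le> (\<integral>\<^sup>+\<omega>. ennreal (g (stake n \<omega>)) \<partial>N)"
    proof (intro nn_integral_mono_AE)
      have "AE \<omega> in N. f \<omega> \<noteq> \<infinity>"
        unfolding f_def using N.RN_deriv_finite[OF M.sigma_finite_measure_axioms ac sets] .
      then show "AE \<omega> in N. f \<omega> * d \<omega> \<le> ennreal (g (stake n \<omega>))"
      proof eventually_elim
        case (elim \<omega>)
        show ?case
        proof (cases "f \<omega> = 0")
          case False
          with elim obtain c where c: "f \<omega> = ennreal c" "0 < c" by (cases "f \<omega>") auto
          then show ?thesis by (simp add: d_def divide_ennreal ennreal_mult[symmetric] g_def)
        qed simp
      qed
    qed
    also have "\<dots> = (\<integral>\<^sup>+xs. ennreal (g xs) \<partial>distr N (count_space UNIV) (stake n))"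
      by (subst nn_integral_distr) auto
    also have "\<dots> = (\<integral>\<^sup>+xs. ennreal (g xs) \<partial>measure_pmf (R n))" unfolding distr_stake[OF N(1)] ..
    also have "\<dots> = (\<integral>\<^sup>+xs. ennreal (pmf (R n) xs) * ennreal (g xs) \<partial>count_space UNIV)"
      by (rule nn_integral_measure_pmf)
    also have "\<dots> = (\<integral>\<^sup>+xs. ennreal (pmf (P n) xs) \<partial>count_space UNIV)"
      using R0 by (intro nn_integral_cong) (auto simp: g_def ennreal_mult[symmetric])
    also have "\<dots> = 1" by (rule nn_integral_pmf_eq_1)
    finally show ?thesis .
  qed
  have d_AE: "AE \<omega> in M. d \<omega> = ennreal (g (stake n \<omega>) / enn2real (f \<omega>))"
    using AEf AEg
  proof eventually_elim
    case (elim \<omega>)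
    then obtain c where "f \<omega> = ennreal c" "0 < c" by (cases "f \<omega>") auto
    then show ?case using elim by (simp add: d_def divide_ennreal)
  qed
  define e where "e \<omega> = g (stake n \<omega>) / enn2real (f \<omega>)" for \<omega>
  have g0: "0 \<le> g xs" for xs by (simp add: g_def)
  have e0: "0 \<le> e \<omega>" for \<omega> by (simp add: e_def g0)
  have e_meas: "e \<in> borel_measurable M"
  proof -
    have "e \<in> borel_measurable N" unfolding e_def by measurable
    then show ?thesis using sets by (simp cong: measurable_cong_sets)
  qed
  have nn_e: "(\<integral>\<^sup>+\<omega>. ennreal (e \<omega>) \<partial>M) \<le> 1"
    using d_le nn_integral_cong_AE[OF d_AE] by (simp add: e_def)
  have int_e: "integrable M e"
    using nn_e e0 e_meas by (intro integrableI_nonneg) (auto simp: less_top[symmetric] top_unique)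
  have "(\<integral>\<omega>. e \<omega> \<partial>M) \<le> 1"
    using nn_e e0 e_meas by (subst integral_eq_nn_integral) (auto intro!: enn2real_leI)
  have int_g: "integrable M (\<lambda>\<omega>. ln (g (stake n \<omega>)))"
  proof -
    have "integrable (measure_pmf (P n)) (\<lambda>xs. ln (g xs))" by (rule integrable_measure_pmf_finite[OF fin])
    then have "integrable (distr M (count_space UNIV) (stake n)) (\<lambda>xs. ln (g xs))" unfolding distr_stake[OF M(1)] .
    then show ?thesis by (subst (asm) integrable_distr_eq) auto
  qed
  have "(\<Sum>xs\<in>set_pmf (P n). pmf (P n) xs * ln (pmf (P n) xs / pmf (R n) xs)) = (\<integral>xs. ln (g xs) \<partial>measure_pmf (P n))"
    using integral_measure_pmf_real[OF fin, of "P n" "\<lambda>xs. ln (g xs)"] by (simp add: g_def mult.commute)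
  also have "\<dots> = (\<integral>\<omega>. ln (g (stake n \<omega>)) \<partial>M)"
    unfolding distr_stake[OF M(1), symmetric] by (subst integral_distr) auto
  also have "\<dots> \<le> (\<integral>\<omega>. entropy_density (exp 1) N M \<omega> + (e \<omega> - 1) \<partial>M)"
  proof (rule integral_mono_AE)
    show "integrable M (\<lambda>\<omega>. entropy_density (exp 1) N M \<omega> + (e \<omega> - 1))"
      using int int_e by auto
    show "AE \<omega> in M. ln (g (stake n \<omega>)) \<le> entropy_density (exp 1) N M \<omega> + (e \<omega> - 1)"
      using AEf AEg
    proof eventually_elim
      case (elim \<omega>)
      then obtain c where c: "f \<omega> = ennreal c" "0 < c" by (cases "f \<omega>") auto
      have "ln (g (stake n \<omega>) / c) \<le> g (stake n \<omega>) / c - 1"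
        using elim c by (intro ln_le_minus_one) auto
      then have "ln (g (stake n \<omega>)) \<le> ln c + (g (stake n \<omega>) / c - 1)"
        using elim c by (simp add: ln_div)
      moreover have "entropy_density (exp 1) N M \<omega> = ln c"
        using c by (simp add: entropy_density_def f_def log_def)
      ultimately show ?case using c by (simp add: e_def)
    qed
  qed (rule int_g)
  also have "\<dots> = (\<integral>\<omega>. entropy_density (exp 1) N M \<omega> \<partial>M) + ((\<integral>\<omega>. e \<omega> \<partial>M) - 1)"
    using int int_e by (simp add: M.prob_space)
  also have "\<dots> \<le> KL_divergence (exp 1) N M"
    using \<open>(\<integral>\<omega>. e \<omega> \<partial>M) \<le> 1\<close> by (simp add: KL_divergence_def)
  finally show ?thesis .
qed

section \<open>Reach-avoid probabilities\<close>

abbreviation full_prefix :: "('n::finite \<Rightarrow> 'st \<Rightarrow> 'ac \<Rightarrow> 'st pmf) \<Rightarrow> (('n \<Rightarrow> 'st) \<Rightarrow> ('n \<Rightarrow> 'ac) pmf)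
    \<Rightarrow> ('n \<Rightarrow> 'st) \<Rightarrow> nat \<Rightarrow> ('n, 'st, 'ac) jstep list pmf" where
  "full_prefix T \<pi> s \<equiv> markov_prefix (full_init \<pi> s) (full_kernel T \<pi>)"

abbreviation int_prefix :: "('n::finite \<Rightarrow> 'st \<Rightarrow> 'ac \<Rightarrow> 'st pmf) \<Rightarrow> (('n \<Rightarrow> 'st) \<Rightarrow> ('n \<Rightarrow> 'ac) pmf)
    \<Rightarrow> ('n \<Rightarrow> 'st) \<Rightarrow> bool pmf \<Rightarrow> nat \<Rightarrow> ('n, 'st, 'ac) jstep list pmf" where
  "int_prefix T \<pi> s \<nu> n \<equiv> map_pmf (map realize) (markov_prefix (int_init \<pi> s \<nu>) (int_kernel T \<pi> \<nu>) n)"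

lemma set_pmf_markov_prefix: "set_pmf (markov_prefix \<mu> K n) \<subseteq> lists_len n"
  by (auto simp: set_pmf_iff pmf_markov_prefix split: if_splits)

lemma set_pmf_int_prefix: "set_pmf (int_prefix T \<pi> s \<nu> n) \<subseteq> lists_len n"
  using set_pmf_markov_prefix[of "int_init \<pi> s \<nu>" "int_kernel T \<pi> \<nu>" n] by auto

lemma prob_eq_sum_lists_len:
  fixes P :: "'x::finite list pmf"
  assumes "set_pmf P \<subseteq> lists_len n"
  shows "measure_pmf.prob P E = (\<Sum>xs\<in>lists_len n \<inter> E. pmf P xs)"
proof -
  have "measure_pmf.prob P E = measure_pmf.prob P (lists_len n \<inter> E)"
    using assms by (intro measure_prob_cong_0) (auto simp: set_pmf_iff)
  then show ?thesis by (simp add: measure_measure_pmf_finite)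
qed

lemma pmf_int_prefix_ge:
  fixes T :: "'n::finite \<Rightarrow> 'st::finite \<Rightarrow> 'ac::finite \<Rightarrow> 'st pmf"
  assumes "length xs = n"
  shows "pmf \<nu> True ^ n * pmf (full_prefix T \<pi> s n) xs \<le> pmf (int_prefix T \<pi> s \<nu> n) xs"
proof (cases "path_weight (full_init \<pi> s) (full_kernel T \<pi>) (rev xs) = 0")
  case True
  then show ?thesis using assms by (simp add: pmf_markov_prefix)
next
  case False
  then have pos: "0 < path_weight (full_init \<pi> s) (full_kernel T \<pi>) (rev xs)"
    by (metis path_weight_nonneg less_eq_real_def)
  show ?thesis using mix_lik_ge[OF pos, of \<nu>] pmf_int_prefix[OF pos, of \<nu>] assms
    by (simp add: pmf_markov_prefix)
qed

lemma prob_int_prefix_ge: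
  fixes T :: "'n::finite \<Rightarrow> 'st::finite \<Rightarrow> 'ac::finite \<Rightarrow> 'st pmf"
  shows "pmf \<nu> True ^ n * measure_pmf.prob (full_prefix T \<pi> s n) E \<le> measure_pmf.prob (int_prefix T \<pi> s \<nu> n) E"
  unfolding prob_eq_sum_lists_len[OF set_pmf_markov_prefix] prob_eq_sum_lists_len[OF set_pmf_int_prefix]
    sum_distrib_left
  by (intro sum_mono pmf_int_prefix_ge) auto

lemma sum_lists_len_rev: "(\<Sum>xs\<in>lists_len n. f (rev xs)) = (\<Sum>h\<in>lists_len n. f h)"
  by (rule sum.reindex_bij_witness[of _ rev rev]) auto

lemma prefix_divergence_eq:
  fixes T :: "'n::finite \<Rightarrow> 'st::finite \<Rightarrow> 'ac::finite \<Rightarrow> 'st pmf"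
  shows "(\<Sum>xs\<in>lists_len n. pmf (full_prefix T \<pi> s n) xs * ln (pmf (full_prefix T \<pi> s n) xs / pmf (int_prefix T \<pi> s \<nu> n) xs))
    = (\<Sum>h\<in>lists_len n. path_weight (full_init \<pi> s) (full_kernel T \<pi>) h *
        ln (path_weight (full_init \<pi> s) (full_kernel T \<pi>) h / mix_lik \<nu> (full_init \<pi> s) (full_kernel T \<pi>) h))"
    (is "?L = sum ?f ?\<Omega>")
proof (rule trans[OF _ sum_lists_len_rev[of ?f n]], intro sum.cong refl)
  fix xs :: "('n, 'st, 'ac) jstep list" assume "xs \<in> lists_len n"
  then have n: "n = length xs" by simp
  let ?w = "path_weight (full_init \<pi> s) (full_kernel T \<pi>) (rev xs)"
  show "pmf (full_prefix T \<pi> s n) xs * ln (pmf (full_prefix T \<pi> s n) xs / pmf (int_prefix T \<pi> s \<nu> n) xs)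
     = ?w * ln (?w / mix_lik \<nu> (full_init \<pi> s) (full_kernel T \<pi>) (rev xs))"
  proof (cases "?w = 0")
    case False
    then have "0 < ?w" by (metis path_weight_nonneg less_eq_real_def)
    from pmf_int_prefix[OF this, of \<nu>] show ?thesis by (simp add: pmf_markov_prefix n)
  qed (simp add: pmf_markov_prefix n)
qed

text \<open>The bound depends on neither \<open>n\<close> nor \<open>E\<close>, so it survives the
  passage from prefix events to success.\<close>

lemma prob_full_diff_le:
  fixes T :: "'n::finite \<Rightarrow> 'st::finite \<Rightarrow> 'ac::finite \<Rightarrow> 'st pmf"
  assumes C: "KL (full_paths T \<pi> s) (img0_paths T \<pi> s) \<noteq> \<infinity>"
  shows "measure_pmf.prob (full_prefix T \<pi> s n) E - measure_pmf.prob (int_prefix T \<pi> s \<nu> n) E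
    \<le> sqrt (1 - exp (- pmf \<nu> False * enn2real (KL (full_paths T \<pi> s) (img0_paths T \<pi> s))))"
proof -
  let ?F = "full_prefix T \<pi> s n" and ?I = "\<lambda>\<nu>. int_prefix T \<pi> s \<nu> n"
  let ?div = "\<lambda>\<nu>. \<Sum>xs\<in>lists_len n. pmf ?F xs * ln (pmf ?F xs / pmf (?I \<nu>) xs)"
  let ?M = "full_paths T \<pi> s" and ?N = "img0_paths T \<pi> s"
  have M: "is_path_measure (full_prefix T \<pi> s) ?M" by (rule is_path_measure_full_paths)
  have N: "is_path_measure (int_prefix T \<pi> s (return_pmf False)) ?N"
    unfolding img0_paths_def by (rule is_path_measure_int_paths)
  have KL: "absolutely_continuous ?N ?M" "integrable ?M (entropy_density (exp 1) ?N ?M)"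
    and KLeq: "KL ?M ?N = ennreal (KL_divergence (exp 1) ?N ?M)"
    using C by (auto simp: KL_def split: if_splits)
  have sub: "set_pmf ?F \<subseteq> lists_len n" by (rule set_pmf_markov_prefix)
  have "?div \<nu> \<le> pmf \<nu> False * ?div (return_pmf False)"
    unfolding prefix_divergence_eq by (rule prefix_divergence_le)
  also have "?div (return_pmf False) = (\<Sum>xs\<in>set_pmf ?F. pmf ?F xs * ln (pmf ?F xs / pmf (?I (return_pmf False)) xs))"
    using sub by (intro sum.mono_neutral_right) (auto simp: set_pmf_iff)
  also have "\<dots> \<le> KL_divergence (exp 1) ?N ?M"
    using KL finite_subset[OF sub finite_lists_len]
    by (intro prefix_divergence_le_KL_divergence[OF M _ N]) auto
  also have "\<dots> \<le> enn2real (KL ?M ?N)" unfolding KLeq by (metis enn2real_ennreal ennreal_neg enn2real_0 linorder_le_cases order_refl)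
  finally have div: "?div \<nu> \<le> pmf \<nu> False * enn2real (KL ?M ?N)" by (simp add: mult_left_mono)
  have "measure_pmf.prob ?F E - measure_pmf.prob (?I \<nu>) E \<le> sqrt (1 - exp (- ?div \<nu>))"
    unfolding prob_eq_sum_lists_len[OF set_pmf_markov_prefix] prob_eq_sum_lists_len[OF set_pmf_int_prefix]
  proof (rule bretagnolle_huber)
    fix xs assume xs: "xs \<in> lists_len n" "0 < pmf ?F xs"
    then have "0 < path_weight (full_init \<pi> s) (full_kernel T \<pi>) (rev xs)" by (simp add: pmf_markov_prefix)
    then show "0 < pmf (?I \<nu>) xs" using pmf_int_prefix[of \<pi> s T xs \<nu>] mix_lik_pos xs by fastforce
  qed (auto intro!: sum_pmf_eq_1 set_pmf_markov_prefix set_pmf_int_prefix)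
  also have "\<dots> \<le> sqrt (1 - exp (- pmf \<nu> False * enn2real (KL ?M ?N)))"
    using div by simp
  finally show ?thesis .
qed

section \<open>First visits to the target\<close>

definition first_hit :: "'s set \<Rightarrow> 's set \<Rightarrow> nat \<Rightarrow> ('s \<times> 'a) list set" where
  "first_hit ST SA m = {xs. fst (xs ! m) \<in> ST \<and> (\<forall>t<m. fst (xs ! t) \<notin> ST \<and> fst (xs ! t) \<notin> SA)}"

definition first_hit_paths :: "'s set \<Rightarrow> 's set \<Rightarrow> nat \<Rightarrow> ('s \<times> 'a) stream set" where
  "first_hit_paths ST SA m = {\<omega>. fst (\<omega> !! m) \<in> ST \<and> (\<forall>t<m. fst (\<omega> !! t) \<notin> ST \<and> fst (\<omega> !! t) \<notin> SA)}"

lemma first_hit_paths_eq: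
  assumes "m < n"
  shows "first_hit_paths ST SA m = {\<omega>. stake n \<omega> \<in> first_hit ST SA m}"
  using assms by (auto simp: first_hit_paths_def first_hit_def)

text \<open>The first visit comes no later than any successful \<open>M\<close>, so it inherits the
  avoid condition.\<close>

lemma reach_avoid_eq: "reach_avoid ST SA = (\<Union>m. first_hit_paths ST SA m)"
proof (intro set_eqI iffI)
  fix \<omega> assume "\<omega> \<in> reach_avoid ST SA"
  then obtain M where M: "fst (\<omega> !! M) \<in> ST" "\<forall>t<M. fst (\<omega> !! t) \<notin> SA" by (auto simp: reach_avoid_def)
  define m where "m = (LEAST m. fst (\<omega> !! m) \<in> ST)"
  have "fst (\<omega> !! m) \<in> ST" unfolding m_def by (rule LeastI[of _ M]) (rule M)
  moreover have "m \<le> M" unfolding m_def by (rule Least_le) (rule M)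
  moreover have "fst (\<omega> !! t) \<notin> ST" if "t < m" for t using that not_less_Least unfolding m_def by blast
  ultimately have "\<omega> \<in> first_hit_paths ST SA m" using M by (auto simp: first_hit_paths_def)
  then show "\<omega> \<in> (\<Union>m. first_hit_paths ST SA m)" by blast
qed (auto simp: reach_avoid_def first_hit_paths_def)

lemma disjoint_first_hit_paths: "disjoint_family (first_hit_paths ST SA)"
  unfolding disjoint_family_on_def
proof (intro ballI impI)
  fix m n :: nat assume "m \<noteq> n"
  then show "first_hit_paths ST SA m \<inter> first_hit_paths ST SA n = {}"
    by (cases m n rule: linorder_cases) (auto simp: first_hit_paths_def)
qed

lemma sets_first_hit_paths:
  fixes P :: "nat \<Rightarrow> ('s::countable \<times> 'a::countable) list pmf"
  assumes M: "is_path_measure P M"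
  shows "first_hit_paths ST SA m \<in> sets M"
  unfolding first_hit_paths_eq[OF lessI] by (rule emeasure_prefix_event(2)[OF M])

lemma sums_first_hit_paths:
  fixes P :: "nat \<Rightarrow> ('s::countable \<times> 'a::countable) list pmf"
  assumes M: "is_path_measure P M" "P 0 = return_pmf []"
  shows "(\<lambda>m. measure M (first_hit_paths ST SA m)) sums measure M (reach_avoid ST SA)"
proof -
  interpret prob_space M by (rule is_path_measure_prob_space[OF M])
  show ?thesis unfolding reach_avoid_eq
    by (rule finite_measure_UNION) (use sets_first_hit_paths[OF M(1)] disjoint_first_hit_paths in auto)
qed

lemma measure_first_hit_paths:
  fixes P :: "nat \<Rightarrow> ('s::countable \<times> 'a::countable) list pmf"
  assumes M: "is_path_measure P M"
  shows "measure M (first_hit_paths ST SA m) = measure_pmf.prob (P (Suc m)) (first_hit ST SA m)"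
  unfolding first_hit_paths_eq[OF lessI] measure_def emeasure_prefix_event(1)[OF M] ..

text \<open>Gathers all first visits before \<open>n\<close> into one prefix event, so that the
  divergence bound is paid once and not per summand.\<close>

lemma sum_measure_first_hit_paths:
  fixes P :: "nat \<Rightarrow> ('s::countable \<times> 'a::countable) list pmf"
  assumes M: "is_path_measure P M" "P 0 = return_pmf []"
  shows "(\<Sum>m<n. measure M (first_hit_paths ST SA m)) = measure_pmf.prob (P n) (\<Union>m<n. first_hit ST SA m)"
proof -
  interpret prob_space M by (rule is_path_measure_prob_space[OF M])
  have "(\<Sum>m<n. measure M (first_hit_paths ST SA m)) = measure M (\<Union>m<n. first_hit_paths ST SA m)"
    using sets_first_hit_paths[OF M(1)] disjoint_family_on_mono[OF subset_UNIV disjoint_first_hit_paths]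
    by (intro finite_measure_finite_Union[symmetric]) auto
  also have "(\<Union>m<n. first_hit_paths ST SA m) = {\<omega>. stake n \<omega> \<in> (\<Union>m<n. first_hit ST SA m)}"
    using first_hit_paths_eq[of _ n ST SA] by auto
  also have "measure M \<dots> = measure_pmf.prob (P n) (\<Union>m<n. first_hit ST SA m)"
    unfolding measure_def emeasure_prefix_event(1)[OF M(1)] ..
  finally show ?thesis .
qed

text \<open>Forgetting the older part \<open>g\<close> and restarting at \<open>x\<close> keeps
  positivity, because each step in \<open>h\<close> depends only on the one before it.\<close>

lemma path_weight_suffix_pos:
  assumes "0 < path_weight \<mu> K (h @ x # g)" "0 < pmf \<mu>' x"
  shows "0 < path_weight \<mu>' K (h @ [x])"
  using assms(1)
proof (induction h)
  case Nil
  show ?case using assms(2) by (simp add: next_step_def)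
next
  case (Cons y h)
  have "0 < path_weight \<mu> K (h @ x # g)" using Cons.prems path_weight_ConsD by (metis append_Cons)
  moreover have "next_step \<mu> K (h @ x # g) = next_step \<mu>' K (h @ [x])" by (cases h) (auto simp: next_step_def)
  ultimately show ?case using Cons by (auto simp: zero_less_mult_iff)
qed

text \<open>The rest of the path from time \<open>t\<close> is itself successful, and by the Markov
  property and stationarity of \<open>\<pi>\<close> it has positive probability from the state at
  \<open>t\<close>.\<close>

lemma first_hit_avoids_dead_states:
  fixes T :: "'n::finite \<Rightarrow> 'st::finite \<Rightarrow> 'ac::finite \<Rightarrow> 'st pmf"
  assumes xs: "xs \<in> set_pmf (full_prefix T \<pi> sI (Suc m))" "xs \<in> first_hit ST SA m" and t: "t < m"
  shows "measure (full_paths T \<pi> (fst (xs ! t))) (reach_avoid ST SA) \<noteq> 0"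
proof -
  let ?K = "full_kernel T \<pi>"
  define s where "s = fst (xs ! t)"
  define ys where "ys = drop t xs"
  have len: "length xs = Suc m" using xs(1) set_pmf_markov_prefix by force
  have w: "0 < path_weight (full_init \<pi> sI) ?K (rev xs)"
    using pmf_positive[OF xs(1)] len unfolding pmf_markov_prefix by simp
  have ys: "ys = xs ! t # drop (Suc t) xs" unfolding ys_def using t len by (intro Cons_nth_drop_Suc[symmetric]) simp
  have "rev xs = rev ys @ rev (take t xs)" unfolding ys_def by (metis append_take_drop_id rev_append)
  then have revxs: "rev xs = rev (drop (Suc t) xs) @ xs ! t # rev (take t xs)" by (simp add: ys)
  \<comment> \<open>A restart at time \<open>t\<close> draws the action anew from
    \<open>\<pi> s\<close>, so the action taken there must be shown to lie in its support.\<close>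
  have "0 < path_weight (full_init \<pi> sI) ?K (xs ! t # rev (take t xs))"
  proof -
    have "0 < path_weight (full_init \<pi> sI) ?K g" if "0 < path_weight (full_init \<pi> sI) ?K (h @ g)" for h g
      using that by (induction h) (auto simp: zero_less_mult_iff)
    then show ?thesis using w revxs by metis
  qed
  then have "xs ! t \<in> set_pmf (next_step (full_init \<pi> sI) ?K (rev (take t xs)))"
    by (auto simp: set_pmf_iff)
  then have "snd (xs ! t) \<in> set_pmf (\<pi> s)"
    unfolding s_def by (auto simp: next_step_def full_init_def full_kernel_def split: list.splits)
  then have "xs ! t \<in> set_pmf (full_init \<pi> s)"
    unfolding full_init_def s_def by (auto intro!: image_eqI[of _ _ "snd (xs ! t)"])
  then have "0 < pmf (full_init \<pi> s) (xs ! t)" by (simp add: pmf_positive)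
  then have "0 < path_weight (full_init \<pi> s) ?K (rev ys)"
    using path_weight_suffix_pos[of "full_init \<pi> sI" ?K "rev (drop (Suc t) xs)" "xs ! t" "rev (take t xs)"] w revxs
    by (simp add: ys)
  then have pos: "0 < pmf (full_prefix T \<pi> s (length ys)) ys" by (simp add: pmf_markov_prefix)
  let ?M = "full_paths T \<pi> s"
  have M: "is_path_measure (full_prefix T \<pi> s) ?M" by (rule is_path_measure_full_paths)
  interpret M: prob_space ?M by (rule is_path_measure_prob_space[OF M]) simp
  have "{\<omega>. stake (length ys) \<omega> = ys} \<subseteq> first_hit_paths ST SA (m - t)"
  proof
    fix \<omega> assume "\<omega> \<in> {\<omega>. stake (length ys) \<omega> = ys}"
    then have eq: "\<omega> !! k = xs ! (t + k)" if "k \<le> m - t" for k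
      using that t len stake_nth[of k "length ys" \<omega>] by (auto simp: ys_def)
    show "\<omega> \<in> first_hit_paths ST SA (m - t)"
      unfolding first_hit_paths_def using xs(2) t eq by (auto simp: first_hit_def)
  qed
  also have "\<dots> \<subseteq> reach_avoid ST SA" unfolding reach_avoid_eq by blast
  finally have "measure ?M {\<omega>. stake (length ys) \<omega> = ys} \<le> measure ?M (reach_avoid ST SA)"
    unfolding reach_avoid_eq using sets_first_hit_paths[OF M] by (intro M.finite_measure_mono) auto
  moreover have "measure ?M {\<omega>. stake (length ys) \<omega> = ys} = pmf (full_prefix T \<pi> s (length ys)) ys"
    using is_path_measure_cylinder[OF M] by (simp add: measure_def)
  ultimately show ?thesis using pos by (simp add: s_def)
qed

lemma path_len_ge:
  assumes "\<And>t. t < m \<Longrightarrow> fst (\<omega> !! t) \<notin> U"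
  shows "of_nat m + 1 \<le> path_len U \<omega>"
proof (cases "\<exists>t. fst (\<omega> !! t) \<in> U")
  case True
  then have "fst (\<omega> !! (LEAST t. fst (\<omega> !! t) \<in> U)) \<in> U" by (rule LeastI_ex)
  then have "m \<le> (LEAST t. fst (\<omega> !! t) \<in> U)" using assms not_less by blast
  then show ?thesis using True by (auto simp: path_len_def intro!: add_mono)
qed (simp add: path_len_def)

text \<open>A first visit at \<open>m\<close> almost surely has length at least
  \<open>m + 1\<close>, since no dead state precedes it. The events are disjoint, so at most one
  summand is nonzero on each path.\<close>

lemma sum_first_hit_le_path_len:
  fixes T :: "'n::finite \<Rightarrow> 'st::finite \<Rightarrow> 'ac::finite \<Rightarrow> 'st pmf"
  assumes SD: "SD \<subseteq> {s. measure (full_paths T \<pi> s) (reach_avoid ST SA) = 0}"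
  shows "ennreal (\<Sum>m<n. real (Suc m) * measure (full_paths T \<pi> sI) (first_hit_paths ST SA m))
    \<le> (\<integral>\<^sup>+ \<omega>. path_len (ST \<union> SD) \<omega> \<partial>full_paths T \<pi> sI)"
proof -
  let ?M = "full_paths T \<pi> sI" and ?G = "first_hit_paths ST SA"
  have M: "is_path_measure (full_prefix T \<pi> sI) ?M" by (rule is_path_measure_full_paths)
  interpret M: prob_space ?M by (rule is_path_measure_prob_space[OF M]) simp
  have G [measurable]: "?G m \<in> sets ?M" for m by (rule sets_first_hit_paths[OF M])
  have AE: "AE \<omega> in ?M. \<forall>m. \<omega> \<in> ?G m \<longrightarrow> of_nat m + 1 \<le> path_len (ST \<union> SD) \<omega>"
    unfolding AE_all_countable
  proof
    fix m
    have "AE xs in distr ?M (count_space UNIV) (stake (Suc m)). xs \<in> first_hit ST SA m \<longrightarrow> (\<forall>t<m. fst (xs ! t) \<notin> SD)"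
      unfolding distr_stake[OF M] AE_measure_pmf_iff
    proof (intro ballI impI allI notI)
      fix xs t assume "xs \<in> set_pmf (full_prefix T \<pi> sI (Suc m))" "xs \<in> first_hit ST SA m"
        "t < m" "fst (xs ! t) \<in> SD"
      then show False using first_hit_avoids_dead_states SD by blast
    qed
    moreover have "stake (Suc m) \<in> measurable ?M (count_space UNIV)"
      unfolding measurable_cong_sets[OF is_path_measure_space(1)[OF M] refl] by measurable
    ultimately have "AE \<omega> in ?M. stake (Suc m) \<omega> \<in> first_hit ST SA m \<longrightarrow> (\<forall>t<m. fst (stake (Suc m) \<omega> ! t) \<notin> SD)"
      by (simp add: AE_distr_iff del: stake.simps)
    then show "AE \<omega> in ?M. \<omega> \<in> ?G m \<longrightarrow> of_nat m + 1 \<le> path_len (ST \<union> SD) \<omega>"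
    proof eventually_elim
      case (elim \<omega>)
      show ?case
      proof
        assume g: "\<omega> \<in> ?G m"
        then have "stake (Suc m) \<omega> \<in> first_hit ST SA m"
          using first_hit_paths_eq[OF lessI, of ST SA m] by blast
        then have "fst (\<omega> !! t) \<notin> SD" if "t < m" for t
          using elim that by (auto simp del: stake.simps simp: stake_nth)
        then show "of_nat m + 1 \<le> path_len (ST \<union> SD) \<omega>"
          using g by (intro path_len_ge) (auto simp: first_hit_paths_def)
      qed
    qed
  qed
  have "ennreal (\<Sum>m<n. real (Suc m) * measure ?M (?G m)) = (\<Sum>m<n. (of_nat m + 1) * emeasure ?M (?G m))"
    by (subst sum_ennreal[symmetric])
       (auto simp: M.emeasure_eq_measure ennreal_mult ennreal_of_nat_eq_real_of_nat ennreal_1[symmetric] ennreal_plus[symmetric]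
         add.commute simp del: ennreal_1 ennreal_plus intro!: sum.cong)
  also have "\<dots> = (\<integral>\<^sup>+ \<omega>. (\<Sum>m<n. (of_nat m + 1) * indicator (?G m) \<omega>) \<partial>?M)"
    using G by (subst nn_integral_sum) (simp_all only: nn_integral_cmult_indicator, measurable)
  also have "\<dots> \<le> (\<integral>\<^sup>+ \<omega>. path_len (ST \<union> SD) \<omega> \<partial>?M)"
  proof (rule nn_integral_mono_AE)
    from AE show "AE \<omega> in ?M. (\<Sum>m<n. (of_nat m + 1) * indicator (?G m) \<omega>) \<le> path_len (ST \<union> SD) \<omega>"
    proof eventually_elim
      case (elim \<omega>)
      show ?case
      proof (cases "\<exists>m<n. \<omega> \<in> ?G m")
        case True
        then obtain m where m: "m < n" "\<omega> \<in> ?G m" by blast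
        then have "indicator (?G k) \<omega> = (if k = m then 1 else 0 :: ennreal)" for k
          using disjoint_first_hit_paths[of ST SA] by (auto simp: disjoint_family_on_def indicator_def)
        then have "(\<Sum>k<n. (of_nat k + 1) * indicator (?G k) \<omega>) = (\<Sum>k<n. if k = m then of_nat k + 1 else (0 :: ennreal))"
          by (intro sum.cong) auto
        also have "\<dots> = of_nat m + 1" using m by simp
        finally show ?thesis using elim m by simp
      next
        case False
        then have "(\<Sum>k<n. (of_nat k + 1) * indicator (?G k) \<omega>) = (0 :: ennreal)"
          by (intro sum.neutral) auto
        then show ?thesis by simp
      qed
    qed
  qed
  finally show ?thesis .
qed

text \<open>Jensen's inequality for \<open>x \<mapsto> r\<^sup>x\<close>, through the tangent at \<open>l / v\<close>.\<close>

lemma geometric_mean_length_bound: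
  fixes p :: "nat \<Rightarrow> real"
  assumes p: "\<And>m. 0 \<le> p m" and v: "p sums v" "0 < v" and r: "0 < r" "r \<le> 1"
    and l: "\<And>n. (\<Sum>m<n. real (Suc m) * p m) \<le> l" and b: "\<And>n. (\<Sum>m<n. r ^ Suc m * p m) \<le> b"
  shows "v * r powr (l / v) \<le> b"
proof -
  \<comment> \<open>An upper bound for the mean of \<open>Suc m\<close> given success. With this
    tangent point the linear term \<open>l - c * v\<close> vanishes in the limit.\<close>
  define c where "c = l / v"
  have lower: "r powr c * ((\<Sum>m<n. p m) + ln r * (l - c * (\<Sum>m<n. p m))) \<le> b" for n
  proof -
    have "r powr c * ((\<Sum>m<n. p m) + ln r * (l - c * (\<Sum>m<n. p m)))
       \<le> r powr c * ((\<Sum>m<n. p m) + ln r * ((\<Sum>m<n. real (Suc m) * p m) - c * (\<Sum>m<n. p m)))"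
      \<comment> \<open>\<open>ln r\<close> is nonpositive, so the larger value \<open>l\<close>
        gives the smaller expression.\<close>
      using l[of n] r by (intro mult_left_mono add_left_mono mult_left_mono_neg) auto
    also have "\<dots> = (\<Sum>m<n. p m * (r powr c * (1 + ln r * (real (Suc m) - c))))"
      by (simp add: algebra_simps sum.distrib sum_subtractf sum_distrib_left)
    also have "\<dots> \<le> (\<Sum>m<n. r ^ Suc m * p m)"
    proof (intro sum_mono)
      fix m
      have "r powr c * (1 + ln r * (real (Suc m) - c)) \<le> r powr c * exp (ln r * (real (Suc m) - c))"
        by (intro mult_left_mono exp_ge_add_one_self) auto
      also have "\<dots> = r powr c * r powr (real (Suc m) - c)" using r by (simp add: powr_def mult.commute)
      also have "\<dots> = r ^ Suc m" using r by (subst powr_add[symmetric]) (simp add: powr_realpow del: of_nat_Suc power_Suc)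
      finally show "p m * (r powr c * (1 + ln r * (real (Suc m) - c))) \<le> r ^ Suc m * p m"
        using p[of m] by (metis mult.commute mult_left_mono)
    qed
    also have "\<dots> \<le> b" by (rule b)
    finally show ?thesis .
  qed
  have "(\<lambda>n. r powr c * ((\<Sum>m<n. p m) + ln r * (l - c * (\<Sum>m<n. p m))))
      \<longlonglongrightarrow> r powr c * (v + ln r * (l - c * v))"
    using v(1) unfolding sums_def by (intro tendsto_intros)
  then have "r powr c * (v + ln r * (l - c * v)) \<le> b"
    using lower by (intro LIMSEQ_le_const2) auto
  then show ?thesis using v(2) by (simp add: c_def mult.commute)
qed

text \<open>For infinite \<open>C\<close> or \<open>l_full\<close>, the exponential and the power
  are read as 0 if \<open>q > 0\<close> and as 1 if \<open>q = 0\<close>.\<close>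

theorem theorem3:
  fixes S :: "'n::finite \<Rightarrow> 'st::finite set"
    and sI :: "'n \<Rightarrow> 'st"
    and A :: "'n \<Rightarrow> 'ac::finite set"
    and T :: "'n \<Rightarrow> 'st \<Rightarrow> 'ac \<Rightarrow> 'st pmf"
    and \<pi> :: "('n \<Rightarrow> 'st) \<Rightarrow> ('n \<Rightarrow> 'ac) pmf"
    and ST SA :: "('n \<Rightarrow> 'st) set"
    and q :: real
  assumes init: "\<And>i. sI i \<in> S i"
    and trans: "\<And>i s a. s \<in> S i \<Longrightarrow> a \<in> A i \<Longrightarrow> set_pmf (T i s a) \<subseteq> S i"
    and pol: "\<And>s. s \<in> Pi UNIV S \<Longrightarrow> set_pmf (\<pi> s) \<subseteq> Pi UNIV A"
    and ST: "ST \<subseteq> Pi UNIV S" and SA: "SA \<subseteq> Pi UNIV S"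
    and q: "0 \<le> q" "q \<le> 1"
    and vpos: "measure (full_paths T \<pi> sI) (reach_avoid ST SA) > 0"
  shows
   "let v_full = measure (full_paths T \<pi> sI) (reach_avoid ST SA);
        v_int = measure (int_paths T \<pi> sI (bernoulli_pmf (1 - q))) (reach_avoid ST SA);
        C = KL (full_paths T \<pi> sI) (img0_paths T \<pi> sI);
        SD = {s \<in> Pi UNIV S. measure (full_paths T \<pi> s) (reach_avoid ST SA) = 0};
        l_full = (\<integral>\<^sup>+ \<omega>. path_len (ST \<union> SD) \<omega> \<partial>full_paths T \<pi> sI);
        exp_qC = (if C = \<infinity> then (if q = 0 then 1 else 0) else exp (- q * enn2real C));
        pow_l = (if l_full = \<infinity> then (if q = 0 then 1 else 0)
                 else (1 - q) powr (enn2real l_full / v_full))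
    in v_int \<ge> max (v_full - sqrt (1 - exp_qC)) (v_full * pow_l)"
proof -
  define \<nu> where "\<nu> = bernoulli_pmf (1 - q)"
  have \<nu>: "pmf \<nu> True = 1 - q" "pmf \<nu> False = q" using q by (auto simp: \<nu>_def)
  let ?F = "full_paths T \<pi> sI" and ?I = "int_paths T \<pi> sI \<nu>" and ?G = "first_hit_paths ST SA"
  define v_full v_int where "v_full = measure ?F (reach_avoid ST SA)" and "v_int = measure ?I (reach_avoid ST SA)"
  define C where "C = KL ?F (img0_paths T \<pi> sI)"
  define SD where "SD = {s \<in> Pi UNIV S. measure (full_paths T \<pi> s) (reach_avoid ST SA) = 0}"
  define l_full where "l_full = (\<integral>\<^sup>+ \<omega>. path_len (ST \<union> SD) \<omega> \<partial>?F)"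
  define p where "p m = measure ?F (?G m)" for m
  have F: "is_path_measure (full_prefix T \<pi> sI) ?F" by (rule is_path_measure_full_paths)
  have I: "is_path_measure (int_prefix T \<pi> sI \<nu>) ?I" by (rule is_path_measure_int_paths)
  interpret F: prob_space ?F by (rule is_path_measure_prob_space[OF F]) simp
  have sums_p: "p sums v_full"
    unfolding p_def v_full_def by (rule sums_first_hit_paths[OF F]) simp
  have sums_I: "(\<lambda>m. measure ?I (?G m)) sums v_int"
    unfolding v_int_def by (rule sums_first_hit_paths[OF I]) simp
  have partial_I: "(\<Sum>m<n. measure ?I (?G m)) \<le> v_int" for n
    unfolding sums_unique[OF sums_I] using sums_summable[OF sums_I] by (rule sum_le_suminf) auto
  \<comment> \<open>A first visit at time \<open>m\<close> is read off a prefix of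
    \<open>Suc m\<close> steps, the same count that \<open>path_len\<close> uses.\<close>
  have lower: "(\<Sum>m<n. (1 - q) ^ Suc m * p m) \<le> v_int" for n
  proof -
    have "(\<Sum>m<n. (1 - q) ^ Suc m * p m) \<le> (\<Sum>m<n. measure ?I (?G m))"
      unfolding p_def measure_first_hit_paths[OF F] measure_first_hit_paths[OF I] \<nu>(1)[symmetric]
      by (intro sum_mono prob_int_prefix_ge)
    then show ?thesis using partial_I[of n] by linarith
  qed
  have q0: "v_full \<le> v_int" if "q = 0"
  proof (rule LIMSEQ_le_const2)
    show "(\<lambda>n. \<Sum>m<n. p m) \<longlonglongrightarrow> v_full" using sums_p by (simp add: sums_def)
    show "\<exists>N. \<forall>n\<ge>N. (\<Sum>m<n. p m) \<le> v_int" using lower that by auto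
  qed
  have v1: "v_full \<le> 1" "0 \<le> v_int" by (auto simp: v_full_def v_int_def)
  have vp: "0 < v_full" using vpos by (simp add: v_full_def)
  have "v_full - sqrt (1 - (if C = \<infinity> then (if q = 0 then 1 else 0) else exp (- q * enn2real C))) \<le> v_int"
  proof (cases "C = \<infinity>")
    case True
    \<comment> \<open>For \<open>q > 0\<close> the claim is just
      \<open>v_full - 1 \<le> v_int\<close>.\<close>
    then show ?thesis using q0 v1 by (cases "q = 0") auto
  next
    case False
    have "(\<Sum>m<n. p m) \<le> v_int + sqrt (1 - exp (- q * enn2real C))" for n
    proof -
      have "(\<Sum>m<n. p m) - (\<Sum>m<n. measure ?I (?G m)) \<le> sqrt (1 - exp (- q * enn2real C))"
        unfolding p_def sum_measure_first_hit_paths[OF F markov_prefix.simps(1)]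
        by (subst sum_measure_first_hit_paths[OF I])
           (use prob_full_diff_le[of T \<pi> sI n _ \<nu>] False in \<open>simp_all add: C_def \<nu>\<close>)
      then show ?thesis using partial_I[of n] by linarith
    qed
    then have "v_full \<le> v_int + sqrt (1 - exp (- q * enn2real C))"
      using sums_p unfolding sums_def by (intro LIMSEQ_le_const2) auto
    then show ?thesis using False by simp
  qed
  moreover have "v_full * (if l_full = \<infinity> then (if q = 0 then 1 else 0)
                 else (1 - q) powr (enn2real l_full / v_full)) \<le> v_int"
  \<comment> \<open>\<open>q = 1\<close> is set apart because the tangent argument takes
    \<open>ln (1 - q)\<close>; there \<open>0 powr _\<close> is 0.\<close>
  proof (cases "l_full = \<infinity> \<or> q = 1")
    case True
    then show ?thesis using q0 v1 by auto
  next
    case False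
    then have fin: "l_full < \<infinity>" and q1: "q < 1" using q by (auto simp: less_top)
    have "(\<Sum>m<n. real (Suc m) * p m) \<le> enn2real l_full" for n
    proof -
      have "ennreal (\<Sum>m<n. real (Suc m) * p m) \<le> l_full"
        unfolding p_def l_full_def by (rule sum_first_hit_le_path_len) (auto simp: SD_def)
      then have "enn2real (ennreal (\<Sum>m<n. real (Suc m) * p m)) \<le> enn2real l_full"
        using fin by (intro enn2real_mono) auto
      moreover have "0 \<le> (\<Sum>m<n. real (Suc m) * p m)" by (intro sum_nonneg) (auto simp: p_def)
      ultimately show ?thesis by simp
    qed
    then have "v_full * (1 - q) powr (enn2real l_full / v_full) \<le> v_int"
      using sums_p vp q q1 lower by (intro geometric_mean_length_bound[of p]) (auto simp: p_def)
    then show ?thesis using False by simp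
  qed
  ultimately show ?thesis
    unfolding Let_def \<nu>_def[symmetric] v_full_def[symmetric] v_int_def[symmetric] C_def[symmetric]
      SD_def[symmetric] l_full_def[symmetric] by simp
qed

end
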